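(* Let $d$ be a positive integer, let $G=(V,E)$ be a graph on at least $d+2$ vertices and define $U=\{v\in V: G-v\text{ is not } d\text{-rigid}\}$. If $|U|\le d-1$, then $G$ is globally $d$-rigid.
   Context: All graphs are finite and simple. A framework in $\mathbb{R}^d$ is a pair $(G,p)$ with $p:V\to\mathbb{R}^d$; it is generic if the coordinates of all $p(v)$ are algebraically independent over $\mathbb{Q}$. The $d$-dimensional generic rigidity matroid $\mathcal{R}_d(G)$ is the row matroid of the rigidity matrix $R(G,p)$ (row of edge $xy$ has $p(x)-p(y)$ in the columns of $x$, $p(y)-p(x)$ in the columns of $y$, zeros elsewhere) for generic $p$; $r_d(G)$ is its rank. A graph $G$ on $n$ vertices is $d$-rigid if $r_d(G)=r_d(K_n)$. $G$ is globally $d$-rigid if for every generic framework $(G,p)$ in $\mathbb{R}^d$, every framework $(G,q)$ in $\mathbb{R}^d$ with $\|p(x)-p(y)\|=\|q(x)-q(y)\|$ for all edges $xy$ satisfies this equality for all pairs $x,y\in V$. *)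

theory Defs
  imports
    "HOL-Analysis.Analysis"
    "HOL-Library.Function_Algebras"
    "HOL-Library.Poly_Mapping"
begin

text \<open>
  Graphs are given by a vertex set and a set of two-element edges. The dimension \<open>d\<close> is
  \<open>CARD('d)\<close> for a finite index type \<open>'d\<close> (so \<open>d > 0\<close>), and is passed as \<open>TYPE('d)\<close> where
  it cannot be inferred.
\<close>

definition complete_edges :: "'v set \<Rightarrow> 'v set set" where
  "complete_edges V = {{x, y} | x y. x \<in> V \<and> y \<in> V \<and> x \<noteq> y}"

definition simple_graph :: "'v set \<Rightarrow> 'v set set \<Rightarrow> bool" where
  "simple_graph V E \<longleftrightarrow> finite V \<and> E \<subseteq> complete_edges V"

definition delete_vertex_edges :: "'v \<Rightarrow> 'v set set \<Rightarrow> 'v set set" where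
  "delete_vertex_edges v E = {e \<in> E. v \<notin> e}"

text \<open>
  A polynomial over \<open>\<rat>\<close> in indeterminates from \<open>'i\<close> is a finitely supported map from
  monomials \<open>'i \<Rightarrow>\<^sub>0 nat\<close> to coefficients.
\<close>

definition eval_rat_poly :: "('i \<Rightarrow> real) \<Rightarrow> (('i \<Rightarrow>\<^sub>0 nat) \<Rightarrow>\<^sub>0 rat) \<Rightarrow> real" where
  "eval_rat_poly a P =
    (\<Sum>m\<in>Poly_Mapping.keys P.
       of_rat (Poly_Mapping.lookup P m) *
       (\<Prod>i\<in>Poly_Mapping.keys m. a i ^ Poly_Mapping.lookup m i))"

text \<open>Independence of the family \<open>(a i)\<^sub>i\<close> for \<open>i \<in> I\<close>; in particular \<open>a\<close> is injective on \<open>I\<close>.\<close>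

definition alg_independent_rat :: "'i set \<Rightarrow> ('i \<Rightarrow> real) \<Rightarrow> bool" where
  "alg_independent_rat I a \<longleftrightarrow>
    (\<forall>P :: ('i \<Rightarrow>\<^sub>0 nat) \<Rightarrow>\<^sub>0 rat.
       (\<forall>m\<in>Poly_Mapping.keys P. Poly_Mapping.keys m \<subseteq> I) \<longrightarrow> eval_rat_poly a P = 0 \<longrightarrow> P = 0)"

definition generic :: "'v set \<Rightarrow> ('v \<Rightarrow> real ^ 'd) \<Rightarrow> bool" where
  "generic V p \<longleftrightarrow> alg_independent_rat (V \<times> UNIV) (\<lambda>(v, i). p v $ i)"

text \<open>
  The row of the rigidity matrix for the edge \<open>{x, y}\<close>. The \<open>d\<close> columns belonging to a
  vertex are grouped into one vector. The row is symmetric in \<open>x\<close> and \<open>y\<close>.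
\<close>

definition rigidity_row :: "('v \<Rightarrow> real ^ 'd) \<Rightarrow> 'v \<Rightarrow> 'v \<Rightarrow> 'v \<Rightarrow> real ^ 'd" where
  "rigidity_row p x y =
    (\<lambda>z. if z = x then p x - p y else if z = y then p y - p x else 0)"

lemma rigidity_row_commute: "rigidity_row p x y = rigidity_row p y x"
  by (auto simp: rigidity_row_def fun_eq_iff)

definition rigidity_rows :: "'v set set \<Rightarrow> ('v \<Rightarrow> real ^ 'd) \<Rightarrow> ('v \<Rightarrow> real ^ 'd) set" where
  "rigidity_rows E p = {rigidity_row p x y | x y. {x, y} \<in> E}"

global_interpretation row_space: vector_space
  "\<lambda>(c :: real) (f :: 'v \<Rightarrow> real ^ 'd). (\<lambda>v. c *\<^sub>R f v)"
  by unfold_locales (auto simp: fun_eq_iff algebra_simps)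

definition rigidity_rank :: "'v set set \<Rightarrow> ('v \<Rightarrow> real ^ 'd) \<Rightarrow> nat" where
  "rigidity_rank E p = row_space.dim (rigidity_rows E p)"

text \<open>
  The rank of the generic rigidity matroid. Generic realisations of a finite \<open>V\<close> exist, and all
  of them give the same row matroid, so the choice of \<open>p\<close> does not matter.
\<close>

definition generic_rank :: "'d::finite itself \<Rightarrow> 'v set \<Rightarrow> 'v set set \<Rightarrow> nat" where
  "generic_rank D V E = rigidity_rank E (SOME p :: 'v \<Rightarrow> real ^ 'd. generic V p)"

definition rigid :: "'d::finite itself \<Rightarrow> 'v set \<Rightarrow> 'v set set \<Rightarrow> bool" where
  "rigid D V E \<longleftrightarrow> generic_rank D V E = generic_rank D V (complete_edges V)"

definition globally_rigid :: "'d::finite itself \<Rightarrow> 'v set \<Rightarrow> 'v set set \<Rightarrow> bool" where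
  "globally_rigid D V E \<longleftrightarrow>
    (\<forall>(p :: 'v \<Rightarrow> real ^ 'd) (q :: 'v \<Rightarrow> real ^ 'd).
       generic V p \<longrightarrow>
       (\<forall>x y. {x, y} \<in> E \<longrightarrow> norm (p x - p y) = norm (q x - q y)) \<longrightarrow>
       (\<forall>x\<in>V. \<forall>y\<in>V. norm (p x - p y) = norm (q x - q y)))"

end

theory Submission
  imports Defs "HOL-Computational_Algebra.Polynomial"
begin

text \<open>
  Fix a generic \<open>p\<close> and an equivalent \<open>q\<close>, and induct on the number of vertices. A vertex
  \<open>v \<notin> U\<close> has degree at least \<open>d + 1\<close>; let \<open>H\<close> arise from \<open>G - v\<close> by joining all neighbours
  of \<open>v\<close>. Rigidity of \<open>G - w\<close> implies rigidity of \<open>H - w\<close>, so \<open>H\<close> satisfies the hypothesis with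
  the same \<open>U\<close>, and for \<open>d + 2\<close> vertices \<open>G\<close> is complete.

  It remains to see that \<open>q\<close> is congruent to \<open>p\<close> on the neighbours of \<open>v\<close>, so that \<open>q\<close> is
  equivalent to \<open>p\<close> on \<open>H\<close>. Algebraic independence enters through derivations of the field of
  reals: they can be prescribed arbitrarily on the coordinates of \<open>p\<close>. A derivation \<open>D\<close> turns
  the equations \<open>\<parallel>p x - p y\<parallel> = \<parallel>q x - q y\<parallel>\<close> into a relation between the rigidity matrices at \<open>p\<close>
  and \<open>q\<close>; hence \<open>G - v\<close> is infinitesimally rigid at \<open>q\<close> as well. If \<open>D\<close> kills the coordinates
  of \<open>p\<close> on \<open>V - v\<close>, then \<open>D q\<close> is an infinitesimal motion of \<open>G - v\<close> at \<open>q\<close>, so \<open>D\<close> kills all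
  inner products of differences of \<open>q\<close> on \<open>V - v\<close>. Differentiating the edge equations at \<open>v\<close>
  twice with such \<open>D\<close> identifies the Gram matrices of \<open>p\<close> and \<open>q\<close> on the neighbours of \<open>v\<close>.
\<close>

section \<open>Derivations of the reals\<close>

definition real_derivation :: "(real \<Rightarrow> real) \<Rightarrow> bool" where
  "real_derivation D \<longleftrightarrow> (\<forall>x y. D (x + y) = D x + D y) \<and> (\<forall>x y. D (x * y) = x * D y + y * D x)"

text \<open>
  Subrings of the dual numbers \<open>x + a \<epsilon>\<close> on which \<open>x\<close> determines \<open>a\<close>: the graphs of derivations
  from a subring of \<open>\<real>\<close> to \<open>\<real>\<close>.
\<close>

definition graph_ring :: "(real \<times> real) set \<Rightarrow> bool" where
  "graph_ring S \<longleftrightarrow> (1, 0) \<in> S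
     \<and> (\<forall>x a y b. (x, a) \<in> S \<longrightarrow> (y, b) \<in> S \<longrightarrow> (x + y, a + b) \<in> S \<and> (x * y, x * b + y * a) \<in> S)
     \<and> (\<forall>x a. (x, a) \<in> S \<longrightarrow> (- x, - a) \<in> S)
     \<and> (\<forall>a. (0, a) \<in> S \<longrightarrow> a = 0)"

section \<open>Extending a derivation by one element\<close>

context
  fixes S assumes S: "graph_ring S"
begin

lemma graph_ring_add: "(x, a) \<in> S \<Longrightarrow> (y, b) \<in> S \<Longrightarrow> (x + y, a + b) \<in> S"
  and graph_ring_mult: "(x, a) \<in> S \<Longrightarrow> (y, b) \<in> S \<Longrightarrow> (x * y, x * b + y * a) \<in> S"
  and graph_ring_minus: "(x, a) \<in> S \<Longrightarrow> (- x, - a) \<in> S"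
  and graph_ring_one: "(1, 0) \<in> S"
  and graph_ring_functional: "(0, a) \<in> S \<Longrightarrow> a = 0"
  using S unfolding graph_ring_def by blast+

lemma graph_ring_zero: "(0, 0) \<in> S"
  using graph_ring_add[OF graph_ring_one graph_ring_minus[OF graph_ring_one]] by simp

lemma graph_ring_of_nat: "(of_nat n, 0) \<in> S"
  by (induction n) (use graph_ring_zero graph_ring_add[OF graph_ring_one] in force)+

lemma graph_ring_sum:
  assumes "\<And>i. i \<in> A \<Longrightarrow> (f i, g i) \<in> S"
  shows "(sum f A, sum g A) \<in> S"
  using assms
  by (induction A rule: infinite_finite_induct) (auto intro: graph_ring_zero graph_ring_add)

text \<open>The second component is the first with the derivation applied to each
  coefficient.\<close>

definition poly_pairs :: "(real poly \<times> real poly) set" where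
  "poly_pairs = {(f, g). \<forall>i. (coeff f i, coeff g i) \<in> S}"

lemma poly_pairs_add: "(f, g) \<in> poly_pairs \<Longrightarrow> (h, k) \<in> poly_pairs \<Longrightarrow> (f + h, g + k) \<in> poly_pairs"
  by (auto simp: poly_pairs_def intro: graph_ring_add)

lemma poly_pairs_minus: "(f, g) \<in> poly_pairs \<Longrightarrow> (- f, - g) \<in> poly_pairs"
  by (auto simp: poly_pairs_def intro: graph_ring_minus)

lemma poly_pairs_mult:
  assumes "(f, g) \<in> poly_pairs" "(h, k) \<in> poly_pairs"
  shows "(f * h, f * k + h * g) \<in> poly_pairs"
proof -
  have "(\<Sum>i\<le>n. coeff f i * coeff h (n - i),
      \<Sum>i\<le>n. coeff f i * coeff k (n - i) + coeff h (n - i) * coeff g i) \<in> S" for n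
    using assms by (intro graph_ring_sum graph_ring_mult) (auto simp: poly_pairs_def)
  moreover have "coeff (f * k + h * g) n =
      (\<Sum>i\<le>n. coeff f i * coeff k (n - i) + coeff h (n - i) * coeff g i)" for n
    by (simp add: coeff_mult sum.distrib mult.commute[of h g]) (simp add: mult.commute)
  ultimately show ?thesis
    by (simp add: poly_pairs_def coeff_mult)
qed

lemma poly_pairs_monom: "(k, l) \<in> S \<Longrightarrow> (monom k n, monom l n) \<in> poly_pairs"
  by (auto simp: poly_pairs_def graph_ring_zero)

lemma poly_pairs_pderiv:
  assumes "(f, g) \<in> poly_pairs"
  shows "(pderiv f, pderiv g) \<in> poly_pairs"
proof -
  have "(of_nat (Suc i) * coeff f (Suc i), of_nat (Suc i) * coeff g (Suc i) + coeff f (Suc i) * 0) \<in> S" for i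
    using assms by (intro graph_ring_mult graph_ring_of_nat) (auto simp: poly_pairs_def)
  then show ?thesis by (simp add: poly_pairs_def coeff_pderiv)
qed

lemma poly_pairs_zero: "(0, g) \<in> poly_pairs \<Longrightarrow> g = 0"
  by (auto simp: poly_pairs_def poly_eq_iff intro: graph_ring_functional)

text \<open>
  The value at \<open>x\<close> of the extension of the derivation to polynomials that maps the
  indeterminate to \<open>a\<close>. It is consistent with evaluation at \<open>x\<close> iff it vanishes on polynomials
  with root \<open>x\<close>, which determines \<open>a\<close> by a polynomial of least degree with root \<open>x\<close>.
\<close>

definition poly_derivation :: "real \<Rightarrow> real \<Rightarrow> real poly \<Rightarrow> real poly \<Rightarrow> real" where
  "poly_derivation x a f g = poly g x + poly (pderiv f) x * a"

lemma poly_derivation_vanishes: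
  obtains a where "\<And>f g. (f, g) \<in> poly_pairs \<Longrightarrow> poly f x = 0 \<Longrightarrow> poly_derivation x a f g = 0"
proof (cases "\<exists>f g. (f, g) \<in> poly_pairs \<and> f \<noteq> 0 \<and> poly f x = 0")
  case False
  show ?thesis
  \<comment> \<open>Here \<open>x\<close> is transcendental over the domain of the derivation; any
    value is consistent, and \<open>0\<close> is chosen.\<close>
  proof (rule that[of 0])
    fix f g assume fg: "(f, g) \<in> poly_pairs" "poly f x = 0"
    with False have "f = 0" by blast
    with fg poly_pairs_zero[of g] show "poly_derivation x 0 f g = 0"
      by (simp add: poly_derivation_def)
  qed
next
  case True
  define P where "P n \<longleftrightarrow> (\<exists>f g. (f, g) \<in> poly_pairs \<and> f \<noteq> 0 \<and> poly f x = 0 \<and> degree f = n)" for n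
  have "\<exists>n. P n" using True unfolding P_def by blast
  then obtain n where n: "P n" "\<And>m. P m \<Longrightarrow> n \<le> m"
    using that[of "LEAST n. P n"] LeastI_ex[of P] Least_le[of P] by blast
  then obtain f g where fg: "(f, g) \<in> poly_pairs" "f \<noteq> 0" "poly f x = 0" "degree f = n"
    unfolding P_def by blast
  have min: "n \<le> degree h" if "(h, k) \<in> poly_pairs" "h \<noteq> 0" "poly h x = 0" for h k
    using n(2) that unfolding P_def by blast
  have "n > 0"
    using fg by (cases "n = 0") (auto elim: degree_eq_zeroE)
  \<comment> \<open>A root of a polynomial of least degree is simple: in characteristic zero the
    derivative of \<open>f\<close> is a nonzero competitor of smaller degree.\<close>
  have nz: "poly (pderiv f) x \<noteq> 0"
  proof
    assume "poly (pderiv f) x = 0"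
    moreover have "pderiv f \<noteq> 0" using fg \<open>n > 0\<close> by (simp add: pderiv_eq_0_iff)
    ultimately have "n \<le> degree (pderiv f)" using min poly_pairs_pderiv[OF fg(1)] by blast
    then show False using fg \<open>n > 0\<close> by (simp add: degree_pderiv)
  qed
  define a where "a = - poly g x / poly (pderiv f) x"
  have a: "poly_derivation x a f g = 0" using nz by (simp add: poly_derivation_def a_def)
  show ?thesis
  proof (rule that[of a])
    fix h k assume "(h, k) \<in> poly_pairs" "poly h x = 0"
    then show "poly_derivation x a h k = 0"
    proof (induction "degree h" arbitrary: h k rule: less_induct)
      case less
      show ?case
      proof (cases "h = 0")
        case True
        with less.prems poly_pairs_zero[of k] show ?thesis by (simp add: poly_derivation_def)
      next
        case False
        \<comment> \<open>Pseudo-division of \<open>h\<close> by \<open>f\<close>: the domain is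
          only a ring, so \<open>h\<close> is multiplied by the leading coefficient \<open>c\<close>
          instead of divided by it. The partner \<open>s\<close> of \<open>r\<close> comes from the
          Leibniz rule.\<close>
        define c m where "c = lead_coeff f" and "m = degree h"
        have "n \<le> m" using min less.prems False m_def by blast
        have S1: "(c, coeff g n) \<in> S" "(lead_coeff h, coeff k m) \<in> S"
          using fg less.prems by (auto simp: poly_pairs_def c_def m_def)
        define C where "C = monom c 0"
        define C' where "C' = monom (coeff g n) 0"
        define B where "B = monom (lead_coeff h) (m - n)"
        define B' where "B' = monom (coeff k m) (m - n)"
        define r where "r = C * h + - (B * f)"
        define s where "s = (C * k + h * C') + - (B * g + f * B')"
        have "(r, s) \<in> poly_pairs" unfolding r_def s_def C_def C'_def B_def B'_def
          by (intro poly_pairs_add poly_pairs_minus poly_pairs_mult poly_pairs_monom S1 fg less.prems)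
        moreover have rx: "poly r x = 0" using fg less.prems by (simp add: r_def)
        moreover have "r = 0 \<or> degree r < m"
        proof -
          have "c \<noteq> 0" using fg(2) by (simp add: c_def)
          have "degree (C * h) = m"
            using \<open>c \<noteq> 0\<close> by (simp add: C_def m_def monom_0)
          moreover have "degree (B * f) = m"
            using False fg(2,4) \<open>n \<le> m\<close> by (simp add: B_def degree_mult_eq degree_monom_eq)
          ultimately have "degree r \<le> m" unfolding r_def by (intro degree_add_le) simp_all
          moreover have "coeff r m = 0"
            using \<open>n \<le> m\<close> fg(4) by (simp add: r_def C_def B_def coeff_monom_mult monom_0 c_def m_def)
          ultimately show ?thesis
            by (metis leading_coeff_0_iff order_le_imp_less_or_eq)
        qed
        ultimately have "poly_derivation x a r s = 0"
          using less.hyps[of r s] poly_pairs_zero[of s] by (auto simp: m_def poly_derivation_def)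
        \<comment> \<open>The Leibniz terms that carry the value of \<open>h\<close> or
          \<open>f\<close> at \<open>x\<close> vanish, as both have the root
          \<open>x\<close>.\<close>
        moreover have "poly_derivation x a r s =
            c * poly_derivation x a h k - poly B x * poly_derivation x a f g"
          using fg(3) less.prems(2)
          by (simp add: poly_derivation_def r_def s_def C_def pderiv_add pderiv_diff pderiv_smult pderiv_mult pderiv_minus
              algebra_simps monom_0 pderiv_pCons poly_monom)
        ultimately show ?thesis using a fg(2) by (simp add: c_def)
      qed
    qed
  qed
qed

text \<open>The ring generated by the domain and \<open>x\<close> consists of the values
  \<open>poly f x\<close>. By the choice of \<open>a\<close>, the derivative of such a value does
  not depend on the polynomial that represents it.\<close>

lemma graph_ring_extend: "\<exists>S'. graph_ring S' \<and> S \<subseteq> S' \<and> x \<in> Domain S'"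
proof -
  obtain a where a: "\<And>f g. (f, g) \<in> poly_pairs \<Longrightarrow> poly f x = 0 \<Longrightarrow> poly_derivation x a f g = 0"
    using poly_derivation_vanishes by blast
  define S' where "S' = {(poly f x, poly_derivation x a f g) | f g. (f, g) \<in> poly_pairs}"
  have S'I: "(y, b) \<in> S'" if "(f, g) \<in> poly_pairs" "y = poly f x" "b = poly_derivation x a f g" for y b f g
    using that by (auto simp: S'_def)
  have const: "(k, l) \<in> S'" if "(k, l) \<in> S" for k l
    by (rule S'I[OF poly_pairs_monom[OF that, of 0]]) (simp_all add: poly_derivation_def monom_0 pderiv_pCons)
  have "graph_ring S'"
    unfolding graph_ring_def
  proof (intro conjI allI impI)
    show "(1, 0) \<in> S'" using const graph_ring_one by blast
  next
    fix y b z c assume "(y, b) \<in> S'" "(z, c) \<in> S'"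
    then obtain f g h k where *: "(f, g) \<in> poly_pairs" "y = poly f x" "b = poly_derivation x a f g"
        "(h, k) \<in> poly_pairs" "z = poly h x" "c = poly_derivation x a h k"
      by (auto simp: S'_def)
    show "(y + z, b + c) \<in> S'"
      by (rule S'I[OF poly_pairs_add[OF *(1,4)]])
        (use * in \<open>simp_all add: poly_derivation_def pderiv_add algebra_simps\<close>)
    show "(y * z, y * c + z * b) \<in> S'"
      by (rule S'I[OF poly_pairs_mult[OF *(1,4)]])
        (use * in \<open>simp_all add: poly_derivation_def pderiv_mult algebra_simps\<close>)
  next
    fix y b assume "(y, b) \<in> S'"
    then obtain f g where *: "(f, g) \<in> poly_pairs" "y = poly f x" "b = poly_derivation x a f g"
      by (auto simp: S'_def)
    show "(- y, - b) \<in> S'"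
      by (rule S'I[OF poly_pairs_minus[OF *(1)]])
        (use * in \<open>simp_all add: poly_derivation_def pderiv_minus\<close>)
  next
    fix b assume "(0, b) \<in> S'"
    then show "b = 0" using a by (auto simp: S'_def)
  qed
  moreover have "S \<subseteq> S'" using const by auto
  moreover have "(x, a) \<in> S'"
    by (rule S'I[OF poly_pairs_monom[OF graph_ring_one, of 1]])
      (simp_all add: poly_derivation_def poly_monom pderiv_monom)
  ultimately show ?thesis by blast
qed

end

text \<open>Zorn's lemma: unions of chains are again graphs of derivations, and a maximal graph has
  every real in its domain, since otherwise one more element could be adjoined.\<close>

lemma graph_ring_derivation:
  assumes "graph_ring S"
  obtains D where "real_derivation D" "\<And>x a. (x, a) \<in> S \<Longrightarrow> D x = a"
proof -
  have "\<exists>M\<in>{T. graph_ring T \<and> S \<subseteq> T}. \<forall>X\<in>{T. graph_ring T \<and> S \<subseteq> T}. M \<subseteq> X \<longrightarrow> X = M"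
  proof (rule subset_Zorn_nonempty)
    show "{T. graph_ring T \<and> S \<subseteq> T} \<noteq> {}" using assms by blast
  next
    fix C assume C: "C \<noteq> {}" "subset.chain {T. graph_ring T \<and> S \<subseteq> T} C"
    then have T: "\<And>T. T \<in> C \<Longrightarrow> graph_ring T \<and> S \<subseteq> T"
      by (auto simp: subset.chain_def)
    have two: "\<exists>T\<in>C. u \<in> T \<and> w \<in> T" if "u \<in> \<Union>C" "w \<in> \<Union>C" for u w
      using that C(2) unfolding subset_chain_def by blast
    have "graph_ring (\<Union>C)"
      unfolding graph_ring_def
    proof (intro conjI allI impI)
      show "(1, 0) \<in> \<Union>C" using C(1) T graph_ring_one by fast
    next
      fix y b z c assume "(y, b) \<in> \<Union>C" "(z, c) \<in> \<Union>C"
      then obtain T' where "T' \<in> C" "(y, b) \<in> T'" "(z, c) \<in> T'" using two by blast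
      then show "(y + z, b + c) \<in> \<Union>C" "(y * z, y * c + z * b) \<in> \<Union>C"
        using T graph_ring_add graph_ring_mult by blast+
    qed (use T graph_ring_minus graph_ring_functional in blast)+
    then show "\<Union>C \<in> {T. graph_ring T \<and> S \<subseteq> T}" using C(1) T by blast
  qed
  then obtain M where M': "M \<in> {T. graph_ring T \<and> S \<subseteq> T}"
      and max': "\<forall>X\<in>{T. graph_ring T \<and> S \<subseteq> T}. M \<subseteq> X \<longrightarrow> X = M" by (rule bexE)
  from M' have M: "graph_ring M" "S \<subseteq> M" by simp_all
  have max: "X = M" if "graph_ring X" "M \<subseteq> X" for X
    using that max' M(2) by simp
  have "\<exists>a. (x, a) \<in> M" for x
  proof -
    obtain X where "graph_ring X" "M \<subseteq> X" "x \<in> Domain X"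
      using graph_ring_extend[OF M(1)] by blast
    then show ?thesis using max by (metis DomainE)
  qed
  then obtain D where D: "\<And>x. (x, D x) \<in> M" by metis
  have uniq: "D x = a" if "(x, a) \<in> M" for x a
  proof -
    have "(x + - x, D x + - a) \<in> M"
      using graph_ring_add[OF M(1) D graph_ring_minus[OF M(1) that]] .
    then show ?thesis using graph_ring_functional[OF M(1)] by fastforce
  qed
  have "real_derivation D"
    unfolding real_derivation_def
    using uniq[OF graph_ring_add[OF M(1) D D]] uniq[OF graph_ring_mult[OF M(1) D D]] by blast
  with uniq M(2) that show ?thesis by blast
qed

section \<open>Rational polynomial functions at generic points\<close>

text \<open>Polynomials are handled as the functions they define, so that sums and products are
  pointwise.\<close>

definition rat_polyfuns :: "'i set \<Rightarrow> (('i \<Rightarrow> real) \<Rightarrow> real) set" where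
  "rat_polyfuns I = {(\<lambda>a. eval_rat_poly a P) | P. \<forall>m\<in>Poly_Mapping.keys P. Poly_Mapping.keys m \<subseteq> I}"

definition monom_fun :: "('i \<Rightarrow>\<^sub>0 nat) \<Rightarrow> ('i \<Rightarrow> real) \<Rightarrow> real" where
  "monom_fun m a = (\<Prod>i\<in>Poly_Mapping.keys m. a i ^ Poly_Mapping.lookup m i)"

lemma eval_rat_poly_monom_fun:
  "eval_rat_poly a P = (\<Sum>m\<in>Poly_Mapping.keys P. of_rat (Poly_Mapping.lookup P m) * monom_fun m a)"
  by (simp add: eval_rat_poly_def monom_fun_def)

lemma monom_fun_superset:
  "finite K \<Longrightarrow> Poly_Mapping.keys m \<subseteq> K \<Longrightarrow> monom_fun m a = (\<Prod>i\<in>K. a i ^ Poly_Mapping.lookup m i)"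
  unfolding monom_fun_def by (rule prod.mono_neutral_left) (auto simp: in_keys_iff)

lemma monom_fun_add: "monom_fun (m + n) a = monom_fun m a * monom_fun n a"
proof -
  define K where "K = Poly_Mapping.keys m \<union> Poly_Mapping.keys n"
  have K: "finite K" "Poly_Mapping.keys m \<subseteq> K" "Poly_Mapping.keys n \<subseteq> K" "Poly_Mapping.keys (m + n) \<subseteq> K"
    using keys_add[of m n] by (auto simp: K_def)
  show ?thesis
    unfolding monom_fun_superset[OF K(1,2)] monom_fun_superset[OF K(1,3)] monom_fun_superset[OF K(1,4)]
    by (simp add: lookup_add power_add prod.distrib)
qed

lemma eval_rat_poly_add: "eval_rat_poly a (P + Q) = eval_rat_poly a P + eval_rat_poly a Q"
  unfolding eval_rat_poly_monom_fun
  by (rule setsum_keys_plus_distrib) (simp_all add: of_rat_add algebra_simps)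

lemma rat_polyfuns_add:
  assumes "f \<in> rat_polyfuns I" "g \<in> rat_polyfuns I"
  shows "(\<lambda>a. f a + g a) \<in> rat_polyfuns I"
proof -
  obtain P Q where P: "f = (\<lambda>a. eval_rat_poly a P)" "\<forall>m\<in>Poly_Mapping.keys P. Poly_Mapping.keys m \<subseteq> I"
    and Q: "g = (\<lambda>a. eval_rat_poly a Q)" "\<forall>m\<in>Poly_Mapping.keys Q. Poly_Mapping.keys m \<subseteq> I"
    using assms by (auto simp: rat_polyfuns_def)
  have "(\<lambda>a. f a + g a) = (\<lambda>a. eval_rat_poly a (P + Q))"
    by (simp add: P Q eval_rat_poly_add)
  moreover have "\<forall>m\<in>Poly_Mapping.keys (P + Q). Poly_Mapping.keys m \<subseteq> I"
    using P Q keys_add[of P Q] by blast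
  ultimately show ?thesis unfolding rat_polyfuns_def by blast
qed

lemma rat_polyfuns_monom:
  assumes "Poly_Mapping.keys m \<subseteq> I"
  shows "(\<lambda>a. of_rat c * monom_fun m a) \<in> rat_polyfuns I"
proof -
  have "(\<lambda>a. of_rat c * monom_fun m a) = (\<lambda>a. eval_rat_poly a (Poly_Mapping.single m c))"
    by (simp add: eval_rat_poly_monom_fun fun_eq_iff)
  moreover have "\<forall>n\<in>Poly_Mapping.keys (Poly_Mapping.single m c). Poly_Mapping.keys n \<subseteq> I"
    using assms by simp
  ultimately show ?thesis unfolding rat_polyfuns_def by blast
qed

lemma rat_polyfuns_const: "(\<lambda>a. of_rat c) \<in> rat_polyfuns I"
  using rat_polyfuns_monom[of 0 I c] by (simp add: monom_fun_def)

lemma rat_polyfuns_var: "i \<in> I \<Longrightarrow> (\<lambda>a. a i) \<in> rat_polyfuns I"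
  using rat_polyfuns_monom[of "Poly_Mapping.single i 1" I 1] by (simp add: monom_fun_def)

lemma rat_polyfuns_sum:
  assumes "\<And>j. j \<in> J \<Longrightarrow> f j \<in> rat_polyfuns I"
  shows "(\<lambda>a. \<Sum>j\<in>J. f j a) \<in> rat_polyfuns I"
  using assms
proof (induction J rule: infinite_finite_induct)
  case (insert j J)
  then show ?case using rat_polyfuns_add[of "f j" I "\<lambda>a. \<Sum>j\<in>J. f j a"] by simp
qed (use rat_polyfuns_const[of 0 I] in simp_all)

lemma rat_polyfuns_mult:
  assumes "f \<in> rat_polyfuns I" "g \<in> rat_polyfuns I"
  shows "(\<lambda>a. f a * g a) \<in> rat_polyfuns I"
proof -
  obtain P Q where P: "f = (\<lambda>a. eval_rat_poly a P)" "\<And>m. m\<in>Poly_Mapping.keys P \<Longrightarrow> Poly_Mapping.keys m \<subseteq> I"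
    and Q: "g = (\<lambda>a. eval_rat_poly a Q)" "\<And>m. m\<in>Poly_Mapping.keys Q \<Longrightarrow> Poly_Mapping.keys m \<subseteq> I"
    using assms by (auto simp: rat_polyfuns_def)
  have "(\<lambda>a. f a * g a) = (\<lambda>a. \<Sum>m\<in>Poly_Mapping.keys P. \<Sum>n\<in>Poly_Mapping.keys Q.
      of_rat (Poly_Mapping.lookup P m * Poly_Mapping.lookup Q n) * monom_fun (m + n) a)"
    by (simp add: P Q eval_rat_poly_monom_fun sum_product monom_fun_add of_rat_mult algebra_simps)
  moreover have "Poly_Mapping.keys (m + n) \<subseteq> I"
    if "m \<in> Poly_Mapping.keys P" "n \<in> Poly_Mapping.keys Q" for m n
    using keys_add[of m n] P(2)[OF that(1)] Q(2)[OF that(2)] by blast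
  ultimately show ?thesis
    by (simp only:) (intro rat_polyfuns_sum rat_polyfuns_monom)
qed

lemma rat_polyfuns_minus:
  "f \<in> rat_polyfuns I \<Longrightarrow> (\<lambda>a. - f a) \<in> rat_polyfuns I"
  using rat_polyfuns_mult[OF rat_polyfuns_const[of "- 1"]] by fastforce

lemma rat_polyfuns_diff:
  "f \<in> rat_polyfuns I \<Longrightarrow> g \<in> rat_polyfuns I \<Longrightarrow> (\<lambda>a. f a - g a) \<in> rat_polyfuns I"
  using rat_polyfuns_add[OF _ rat_polyfuns_minus] by fastforce

text \<open>A polynomial with a nonzero value at some \<open>b\<close> is not the zero polynomial,
  so algebraic independence forbids it to vanish at \<open>a\<close>.\<close>

lemma rat_polyfuns_nonzero:
  assumes "alg_independent_rat I a" "f \<in> rat_polyfuns I" "f b \<noteq> 0"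
  shows "f a \<noteq> 0"
proof
  obtain P where P: "f = (\<lambda>a. eval_rat_poly a P)" "\<forall>m\<in>Poly_Mapping.keys P. Poly_Mapping.keys m \<subseteq> I"
    using assms(2) by (auto simp: rat_polyfuns_def)
  assume "f a = 0"
  then have "P = 0" using assms(1) P unfolding alg_independent_rat_def by simp
  then show False using assms(3) P by (simp add: eval_rat_poly_def)
qed

text \<open>On rational polynomials in the \<open>a i\<close> take the directional derivative along
  \<open>c\<close>. By algebraic independence a polynomial function is determined by its value at
  \<open>a\<close>, so this is the graph of a derivation on a subring, which extends to all
  reals.\<close>

lemma exists_derivation:
  assumes "alg_independent_rat I a"
  obtains D where "real_derivation D" "\<And>i. i \<in> I \<Longrightarrow> D (a i) = c i"
proof -
  define along where "along f = (\<lambda>t. f (\<lambda>i. a i + t * c i))" for f :: "('a \<Rightarrow> real) \<Rightarrow> real"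
  define S where "S = {(f a, l) | f l. f \<in> rat_polyfuns I \<and> (along f has_real_derivative l) (at 0)}"
  have SI: "(x, l) \<in> S" if "f \<in> rat_polyfuns I" "(along f has_real_derivative l) (at 0)" "x = f a" for f l x
    using that by (auto simp: S_def)
  have along0: "along f 0 = f a" for f by (simp add: along_def)
  have "graph_ring S"
    unfolding graph_ring_def
  proof (intro conjI allI impI)
    show "(1, 0) \<in> S"
      by (rule SI[OF rat_polyfuns_const[of 1]]) (auto simp: along_def)
  next
    fix x l y k assume "(x, l) \<in> S" "(y, k) \<in> S"
    then obtain f g where f: "f \<in> rat_polyfuns I" "(along f has_real_derivative l) (at 0)" "x = f a"
      and g: "g \<in> rat_polyfuns I" "(along g has_real_derivative k) (at 0)" "y = g a"
      by (auto simp: S_def)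
    show "(x + y, l + k) \<in> S"
      using DERIV_add[OF f(2) g(2)]
      by (intro SI[OF rat_polyfuns_add[OF f(1) g(1)]]) (simp_all add: f g along_def)
    show "(x * y, x * k + y * l) \<in> S"
      using DERIV_mult[OF f(2) g(2)]
      by (intro SI[OF rat_polyfuns_mult[OF f(1) g(1)]]) (simp_all add: f g along_def algebra_simps)
  next
    fix x l assume "(x, l) \<in> S"
    then obtain f where f: "f \<in> rat_polyfuns I" "(along f has_real_derivative l) (at 0)" "x = f a"
      by (auto simp: S_def)
    show "(- x, - l) \<in> S"
      using DERIV_minus[OF f(2)]
      by (intro SI[OF rat_polyfuns_minus[OF f(1)]]) (simp_all add: f along_def)
  next
    fix l assume "(0, l) \<in> S"
    then obtain f where f: "f \<in> rat_polyfuns I" "(along f has_real_derivative l) (at 0)" "f a = 0"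
      by (auto simp: S_def)
    then have "along f = (\<lambda>t. 0)"
      using rat_polyfuns_nonzero[OF assms f(1)] by (auto simp: along_def fun_eq_iff)
    with f(2) show "l = 0" using DERIV_unique[OF _ DERIV_const] by simp
  qed
  then obtain D where D: "real_derivation D" "\<And>x l. (x, l) \<in> S \<Longrightarrow> D x = l"
    using graph_ring_derivation by blast
  have "(a i, c i) \<in> S" if "i \<in> I" for i
    by (rule SI[OF rat_polyfuns_var[OF that]]) (auto simp: along_def intro!: derivative_eq_intros)
  with D that show ?thesis by blast
qed

section \<open>Derivations applied to sums, vectors and inner products\<close>

context
  fixes D assumes D: "real_derivation D"
begin

lemma derivation_add: "D (x + y) = D x + D y"
  and derivation_mult: "D (x * y) = x * D y + y * D x"
  using D by (auto simp: real_derivation_def)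

lemma derivation_0: "D 0 = 0"
  using derivation_add[of 0 0] by simp

lemma derivation_1: "D 1 = 0"
  using derivation_mult[of 1 1] by simp

lemma derivation_minus: "D (- x) = - D x"
  using derivation_add[of x "- x"] derivation_0 by simp

lemma derivation_diff: "D (x - y) = D x - D y"
  using derivation_add[of x "- y"] derivation_minus by simp

lemma derivation_sum: "D (sum f A) = (\<Sum>x\<in>A. D (f x))"
  by (induction A rule: infinite_finite_induct) (simp_all add: derivation_0 derivation_add)

end

definition derivation_vec :: "(real \<Rightarrow> real) \<Rightarrow> real ^ 'n \<Rightarrow> real ^ 'n" where
  "derivation_vec D x = (\<chi> i. D (x $ i))"

lemma derivation_vec_nth [simp]: "derivation_vec D x $ i = D (x $ i)"
  by (simp add: derivation_vec_def)

lemma derivation_vec_diff: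
  "real_derivation D \<Longrightarrow> derivation_vec D (x - y) = derivation_vec D x - derivation_vec D y"
  by (simp add: vec_eq_iff derivation_diff)

lemma derivation_vec_sum_scaleR:
  assumes "real_derivation D"
  shows "derivation_vec D (\<Sum>t\<in>T. l t *\<^sub>R f t) =
    (\<Sum>t\<in>T. D (l t) *\<^sub>R f t) + (\<Sum>t\<in>T. l t *\<^sub>R derivation_vec D (f t))"
  by (simp add: vec_eq_iff derivation_sum[OF assms] derivation_mult[OF assms] sum.distrib algebra_simps)

lemma derivation_inner:
  assumes "real_derivation D"
  shows "D (x \<bullet> y) = derivation_vec D x \<bullet> y + x \<bullet> derivation_vec D y"
  by (simp add: inner_vec_def derivation_sum[OF assms] derivation_mult[OF assms] sum.distrib algebra_simps)

lemma generic_exists_derivation: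
  fixes p c :: "'v \<Rightarrow> real ^ 'd"
  assumes "generic V p"
  obtains D where "real_derivation D" "\<And>v. v \<in> V \<Longrightarrow> derivation_vec D (p v) = c v"
proof -
  obtain D where "real_derivation D"
      "\<And>j. j \<in> V \<times> UNIV \<Longrightarrow> D ((\<lambda>(v, i). p v $ i) j) = (\<lambda>(v, i). c v $ i) j"
    using exists_derivation[OF assms[unfolded generic_def]] by metis
  with that[of D] show ?thesis by (auto simp: vec_eq_iff)
qed

lemma generic_subset: "generic V p \<Longrightarrow> W \<subseteq> V \<Longrightarrow> generic W p"
  unfolding generic_def alg_independent_rat_def by blast

text \<open>Gaussian elimination, with a pivot that does not vanish at \<open>b\<close> and hence not at \<open>a\<close>.\<close>

lemma rat_polyfuns_independent:
  fixes f :: "'e \<Rightarrow> 'j \<Rightarrow> ('i \<Rightarrow> real) \<Rightarrow> real"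
  assumes a: "alg_independent_rat I a"
    and "finite F"
    and "\<And>e j. e \<in> F \<Longrightarrow> f e j \<in> rat_polyfuns I"
    and "\<And>l. (\<And>j. (\<Sum>e\<in>F. l e * f e j b) = 0) \<Longrightarrow> \<forall>e\<in>F. l e = 0"
    and "\<And>j. (\<Sum>e\<in>F. l e * f e j a) = 0"
  shows "\<forall>e\<in>F. l e = 0"
  using assms(2-)
proof (induction F arbitrary: f)
  case (insert e0 F)
  have "\<exists>j. f e0 j b \<noteq> 0"
  proof (rule ccontr)
    assume "\<nexists>j. f e0 j b \<noteq> 0"
    then have "(\<Sum>e\<in>insert e0 F. (if e = e0 then 1 else 0) * f e j b) = 0" for j
      by (intro sum.neutral) auto
    from insert.prems(2)[OF this] show False by auto
  qed
  then obtain j0 where j0: "f e0 j0 b \<noteq> 0" by blast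
  then have j0a: "f e0 j0 a \<noteq> 0"
    using rat_polyfuns_nonzero[OF a insert.prems(1)] by blast
  \<comment> \<open>Row \<open>e\<close> after elimination of column \<open>j0\<close> with the
    pivot row \<open>e0\<close>, cross-multiplied so that it stays polynomial.\<close>
  define g where "g e j = (\<lambda>a. f e0 j0 a * f e j a - f e j0 a * f e0 j a)" for e j
  have "\<forall>e\<in>F. l e = 0"
  proof (rule insert.IH[of g])
    show "g e j \<in> rat_polyfuns I" if "e \<in> F" for e j
      unfolding g_def using that insert.prems(1)
      by (intro rat_polyfuns_diff rat_polyfuns_mult) auto
  next
    fix k assume k: "\<And>j. (\<Sum>e\<in>F. k e * g e j b) = 0"
    \<comment> \<open>A relation \<open>k\<close> among the eliminated rows lifts to the original
      rows; the coefficient at \<open>e0\<close> is the one that cancels column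
      \<open>j0\<close>.\<close>
    define k' where "k' e = (if e = e0 then - (\<Sum>e\<in>F. k e * f e j0 b) else k e * f e0 j0 b)" for e
    have "(\<Sum>e\<in>insert e0 F. k' e * f e j b) = 0" for j
    proof -
      have "(\<Sum>e\<in>F. k' e * f e j b) = (\<Sum>e\<in>F. k e * f e0 j0 b * f e j b)"
        using insert.hyps by (intro sum.cong) (auto simp: k'_def)
      then have "(\<Sum>e\<in>insert e0 F. k' e * f e j b) =
          - (\<Sum>e\<in>F. k e * f e j0 b) * f e0 j b + (\<Sum>e\<in>F. k e * f e0 j0 b * f e j b)"
        using insert.hyps by (simp add: k'_def)
      also have "\<dots> = (\<Sum>e\<in>F. k e * g e j b)"
        by (simp add: g_def sum_distrib_left sum_distrib_right sum_subtractf right_diff_distrib mult_ac)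
      finally show ?thesis using k by simp
    qed
    from insert.prems(2)[OF this] show "\<forall>e\<in>F. k e = 0"
      using insert.hyps j0 by (auto simp: k'_def split: if_splits)
  next
    fix j
    have rel: "(\<Sum>e\<in>F. l e * f e j a) = - (l e0 * f e0 j a)" for j
      using insert.prems(3)[of j] insert.hyps by simp
    have "(\<Sum>e\<in>F. l e * g e j a) =
        f e0 j0 a * (\<Sum>e\<in>F. l e * f e j a) - (\<Sum>e\<in>F. l e * f e j0 a) * f e0 j a"
      by (simp add: g_def sum_distrib_right sum_distrib_left sum_subtractf right_diff_distrib mult_ac)
    then show "(\<Sum>e\<in>F. l e * g e j a) = 0" by (simp add: rel)
  qed
  moreover from this have "l e0 * f e0 j0 a = 0"
    using insert.prems(3)[of j0] insert.hyps by simp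
  ultimately show ?case using j0a by simp
qed simp

section \<open>Infinitesimal rigidity\<close>

text \<open>The row as a function of the edge itself, without naming its endpoints: the summand
  \<open>y = z\<close> vanishes, which leaves the other endpoint.\<close>

definition edge_row :: "('v \<Rightarrow> real ^ 'd) \<Rightarrow> 'v set \<Rightarrow> 'v \<Rightarrow> real ^ 'd" where
  "edge_row p e z = (if z \<in> e then \<Sum>y\<in>e. p z - p y else 0)"

lemma edge_row_doubleton: "edge_row p {x, y} = rigidity_row p x y"
  by (cases "x = y") (auto simp: edge_row_def rigidity_row_def fun_eq_iff)

lemma complete_edgesE:
  assumes "e \<in> complete_edges V"
  obtains x y where "e = {x, y}" "x \<in> V" "y \<in> V" "x \<noteq> y"
  using assms by (auto simp: complete_edges_def)

lemma complete_edges_iff: "{x, y} \<in> complete_edges V \<longleftrightarrow> x \<in> V \<and> y \<in> V \<and> x \<noteq> y"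
  by (auto simp: complete_edges_def doubleton_eq_iff)

lemma complete_edges_mono: "A \<subseteq> B \<Longrightarrow> complete_edges A \<subseteq> complete_edges B"
  unfolding complete_edges_def by blast

lemma finite_complete_edges: "finite V \<Longrightarrow> finite (complete_edges V)"
  by (rule finite_subset[of _ "Pow V"]) (auto simp: complete_edges_def)

lemma rigidity_rows_eq:
  assumes "E \<subseteq> complete_edges V"
  shows "rigidity_rows E p = edge_row p ` E"
proof (intro set_eqI iffI)
  fix r assume "r \<in> edge_row p ` E"
  then obtain e where e: "e \<in> E" "r = edge_row p e" by blast
  then obtain x y where "e = {x, y}" using assms by (meson complete_edgesE subsetD)
  then show "r \<in> rigidity_rows E p" using e by (auto simp: rigidity_rows_def edge_row_doubleton)
qed (auto simp: rigidity_rows_def edge_row_doubleton[symmetric])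

text \<open>The standard inner product on the columns of \<open>V\<close>; infinitesimal motions are
  the vectors orthogonal to the edge rows.\<close>

definition row_pairing :: "'v set \<Rightarrow> ('v \<Rightarrow> real ^ 'd) \<Rightarrow> ('v \<Rightarrow> real ^ 'd) \<Rightarrow> real" where
  "row_pairing V r m = (\<Sum>z\<in>V. r z \<bullet> m z)"

lemma row_pairing_edge_row:
  assumes "finite V" "x \<in> V" "y \<in> V" "x \<noteq> y"
  shows "row_pairing V (edge_row p {x, y}) m = (p x - p y) \<bullet> (m x - m y)"
proof -
  have "row_pairing V (edge_row p {x, y}) m = (\<Sum>z\<in>{x, y}. edge_row p {x, y} z \<bullet> m z)"
    unfolding row_pairing_def using assms
    by (intro sum.mono_neutral_right) (auto simp: edge_row_def)
  then show ?thesis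
    using assms by (simp add: edge_row_doubleton rigidity_row_def inner_diff_left inner_diff_right)
qed

definition infinitesimal_motion :: "'v set set \<Rightarrow> ('v \<Rightarrow> real ^ 'd) \<Rightarrow> ('v \<Rightarrow> real ^ 'd) \<Rightarrow> bool" where
  "infinitesimal_motion E p m \<longleftrightarrow> (\<forall>x y. {x, y} \<in> E \<longrightarrow> (p x - p y) \<bullet> (m x - m y) = 0)"

lemma infinitesimal_motion_mono:
  "infinitesimal_motion E p m \<Longrightarrow> F \<subseteq> E \<Longrightarrow> infinitesimal_motion F p m"
  by (auto simp: infinitesimal_motion_def)

text \<open>Trivial motions are taken to be the motions of the complete graph, which makes rigidity
  a comparison of two row spaces.\<close>

definition inf_rigid :: "'v set \<Rightarrow> 'v set set \<Rightarrow> ('v \<Rightarrow> real ^ 'd) \<Rightarrow> bool" where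
  "inf_rigid V E p \<longleftrightarrow> (\<forall>m. infinitesimal_motion E p m \<longrightarrow> infinitesimal_motion (complete_edges V) p m)"

lemma infinitesimal_motion_iff:
  assumes "finite V" "E \<subseteq> complete_edges V"
  shows "infinitesimal_motion E p m \<longleftrightarrow> (\<forall>e\<in>E. row_pairing V (edge_row p e) m = 0)"
proof
  assume L: "infinitesimal_motion E p m"
  show "\<forall>e\<in>E. row_pairing V (edge_row p e) m = 0"
  proof
    fix e assume "e \<in> E"
    moreover from this obtain x y where "e = {x, y}" "x \<in> V" "y \<in> V" "x \<noteq> y"
      using assms by (meson complete_edgesE subsetD)
    ultimately show "row_pairing V (edge_row p e) m = 0"
      using L assms by (simp add: row_pairing_edge_row infinitesimal_motion_def)
  qed
next
  assume R: "\<forall>e\<in>E. row_pairing V (edge_row p e) m = 0"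
  show "infinitesimal_motion E p m"
    unfolding infinitesimal_motion_def
  proof (intro allI impI)
    fix x y assume "{x, y} \<in> E"
    moreover from this have "{x, y} \<in> complete_edges V" using assms(2) by blast
    then have "x \<in> V" "y \<in> V" "x \<noteq> y" by (simp_all add: complete_edges_iff)
    ultimately show "(p x - p y) \<bullet> (m x - m y) = 0"
      using R assms(1) row_pairing_edge_row[of V x y p m] by auto
  qed
qed

lemma row_pairing_span:
  assumes "r \<in> row_space.span R" "\<And>f. f \<in> R \<Longrightarrow> row_pairing V f m = 0"
  shows "row_pairing V r m = 0"
  using assms(1)
proof (induction rule: row_space.span_induct)
  case base
  show ?case
    by (rule row_space.subspaceI)
      (auto simp: row_pairing_def inner_add_left sum.distrib sum_distrib_left[symmetric])
qed (use assms in auto)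

lemma row_pairing_commute: "row_pairing V r m = row_pairing V m r"
  by (simp add: row_pairing_def inner_commute)

lemma row_pairing_diff_left: "row_pairing V (r - s) m = row_pairing V r m - row_pairing V s m"
  by (simp add: row_pairing_def inner_diff_left sum_subtractf)

lemma row_pairing_scale_left: "row_pairing V (\<lambda>v. c *\<^sub>R r v) m = c * row_pairing V r m"
  by (simp add: row_pairing_def sum_distrib_left)

lemma row_pairing_self_eq_0:
  assumes "finite V" "row_pairing V r r = 0" "z \<in> V"
  shows "r z = 0"
  using assms by (simp add: row_pairing_def sum_nonneg_eq_0_iff)

text \<open>Orthogonal projection onto the span by Gram-Schmidt. The induction is over all
  \<open>r\<close>, because both \<open>f\<close> and \<open>r\<close> are projected onto the span
  of the smaller set.\<close>

lemma row_projection: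
  assumes "finite V" "finite R"
  shows "\<exists>s\<in>row_space.span R. \<forall>f\<in>R. row_pairing V f (r - s) = 0"
  using assms(2)
proof (induction R arbitrary: r)
  case empty
  then show ?case using row_space.span_zero by blast
next
  case (insert f R)
  obtain s where s: "s \<in> row_space.span R" "\<And>g. g \<in> R \<Longrightarrow> row_pairing V g (f - s) = 0"
    using insert.IH by blast
  obtain t where t: "t \<in> row_space.span R" "\<And>g. g \<in> R \<Longrightarrow> row_pairing V g (r - t) = 0"
    using insert.IH by blast
  have sub: "row_space.span R \<subseteq> row_space.span (insert f R)"
    by (intro row_space.span_mono) auto
  \<comment> \<open>The coefficient along the part of \<open>f\<close> orthogonal to
    \<open>R\<close>. If that part has norm zero, division yields \<open>c = 0\<close>, and every
    pairing with that part vanishes.\<close>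
  define c where "c = row_pairing V (f - s) (r - t) / row_pairing V (f - s) (f - s)"
  define u where "u = t + (\<lambda>v. c *\<^sub>R (f - s) v)"
  have "u \<in> row_space.span (insert f R)"
    unfolding u_def using s t sub
    by (intro row_space.span_add row_space.span_scale row_space.span_diff)
      (auto intro: row_space.span_base)
  moreover have ru: "row_pairing V g (r - u) = row_pairing V g (r - t) - c * row_pairing V g (f - s)" for g
  proof -
    have "r - u = (r - t) - (\<lambda>v. c *\<^sub>R (f - s) v)" by (simp add: u_def)
    then show ?thesis
      by (simp only: row_pairing_commute[of V g] row_pairing_diff_left[of V "r - t"] row_pairing_scale_left)
  qed
  have orth: "row_pairing V g (r - u) = 0" if "g \<in> R" for g
    using ru s t that by simp
  have "row_pairing V (f - s) (r - u) = 0"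
  proof (cases "row_pairing V (f - s) (f - s) = 0")
    case True
    then have "row_pairing V (f - s) g = 0" for g
      using row_pairing_self_eq_0[OF assms(1) True]
      by (auto simp: row_pairing_def intro!: sum.neutral)
    then show ?thesis by simp
  qed (simp add: ru c_def)
  moreover have "row_pairing V s (r - u) = 0"
    using row_pairing_span[OF s(1)] orth by blast
  ultimately have "row_pairing V f (r - u) = 0"
    by (simp add: row_pairing_diff_left)
  with orth \<open>u \<in> _\<close> show ?case by blast
qed

text \<open>Motions form the orthogonal complement of the rows. For the direction from motions to
  spans, the difference of a row and its projection is a motion of \<open>E\<close>, hence of the
  complete graph, hence orthogonal to itself.\<close>

lemma inf_rigid_iff_span:
  assumes V: "finite V" and E: "E \<subseteq> complete_edges V"
  shows "inf_rigid V E p \<longleftrightarrow> edge_row p ` complete_edges V \<subseteq> row_space.span (edge_row p ` E)"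
proof
  assume R: "edge_row p ` complete_edges V \<subseteq> row_space.span (edge_row p ` E)"
  show "inf_rigid V E p"
    unfolding inf_rigid_def infinitesimal_motion_iff[OF V E] infinitesimal_motion_iff[OF V order_refl]
  proof (intro allI impI ballI)
    fix m e assume m: "\<forall>e\<in>E. row_pairing V (edge_row p e) m = 0" and e: "e \<in> complete_edges V"
    then have "edge_row p e \<in> row_space.span (edge_row p ` E)" using R by blast
    then show "row_pairing V (edge_row p e) m = 0"
      by (rule row_pairing_span) (use m in auto)
  qed
next
  assume L: "inf_rigid V E p"
  have "finite (edge_row p ` E)"
    using finite_complete_edges[OF V] E finite_subset by blast
  show "edge_row p ` complete_edges V \<subseteq> row_space.span (edge_row p ` E)"
  proof
    fix r assume "r \<in> edge_row p ` complete_edges V"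
    then obtain e where e: "e \<in> complete_edges V" "r = edge_row p e" by blast
    obtain s where s: "s \<in> row_space.span (edge_row p ` E)"
        "\<And>f. f \<in> edge_row p ` E \<Longrightarrow> row_pairing V f (r - s) = 0"
      using row_projection[OF V \<open>finite (edge_row p ` E)\<close>] by blast
    then have "infinitesimal_motion E p (r - s)"
      by (subst infinitesimal_motion_iff[OF V E]) auto
    then have "infinitesimal_motion (complete_edges V) p (r - s)"
      using L by (simp add: inf_rigid_def)
    then have "row_pairing V r (r - s) = 0"
      using e by (subst (asm) infinitesimal_motion_iff[OF V order_refl]) auto
    moreover have "row_pairing V s (r - s) = 0"
      using row_pairing_span[OF s(1)] s(2) by blast
    ultimately have "row_pairing V (r - s) (r - s) = 0"
      by (subst row_pairing_diff_left) simp
    then have on: "(r - s) z = 0" if "z \<in> V" for z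
      using row_pairing_self_eq_0[OF V _ that] by blast
    \<comment> \<open>The pairing determines rows on \<open>V\<close> only; outside \<open>V\<close>
      all edge rows vanish, and so does their span.\<close>
    have out: "edge_row p e' z = 0" if "e' \<in> complete_edges V" "z \<notin> V" for e' z
      using that by (auto simp: edge_row_def complete_edges_def)
    have "s z = 0" if "z \<notin> V" for z
      using s(1)
    proof (induction rule: row_space.span_induct)
      case base
      show ?case by (rule row_space.subspaceI) auto
    next
      case (step x)
      then show ?case using out E that by blast
    qed
    then have "(r - s) z = 0" for z
      using on[of z] out[OF e(1)] e(2) by (cases "z \<in> V") auto
    then have "r = s" by (auto simp: fun_eq_iff)
    then show "r \<in> row_space.span (edge_row p ` E)" using s by simp
  qed
qed

section \<open>Independent edge sets and transfer of rigidity between placements\<close>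

definition row_independent :: "('v \<Rightarrow> real ^ 'd) \<Rightarrow> 'v set set \<Rightarrow> bool" where
  "row_independent p F \<longleftrightarrow>
    (\<forall>l. (\<forall>z. (\<Sum>e\<in>F. l e *\<^sub>R edge_row p e z) = 0) \<longrightarrow> (\<forall>e\<in>F. l e = 0))"

lemma sum_fun_apply: "sum f A z = (\<Sum>x\<in>A. f x z)"
  by (induction A rule: infinite_finite_induct) auto

lemma row_independent_empty: "row_independent p {}"
  by (simp add: row_independent_def)

text \<open>The rows count as a family indexed by edges, so distinct edges with equal rows are
  dependent. This is why a new edge \<open>e\<close> is assumed: for \<open>e\<close> in
  \<open>F\<close> the equivalence would fail.\<close>

lemma row_independent_insert:
  assumes F: "finite F" "row_independent p F" "e \<notin> F"
  shows "row_independent p (insert e F) \<longleftrightarrow> edge_row p e \<notin> row_space.span (edge_row p ` F)"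
proof
  assume L: "row_independent p (insert e F)"
  show "edge_row p e \<notin> row_space.span (edge_row p ` F)"
  proof
    have "row_space.span (edge_row p ` F) \<subseteq> range (\<lambda>l z. \<Sum>f\<in>F. l f *\<^sub>R edge_row p f z)"
    proof (rule row_space.span_minimal)
      show "edge_row p ` F \<subseteq> range (\<lambda>l z. \<Sum>f\<in>F. l f *\<^sub>R edge_row p f z)"
      proof clarify
        fix f assume "f \<in> F"
        then have "edge_row p f = (\<lambda>z. \<Sum>g\<in>F. (if g = f then 1 else 0) *\<^sub>R edge_row p g z)"
          using F(1) by (simp add: fun_eq_iff if_distrib[of "\<lambda>c. c *\<^sub>R _"] cong: if_cong)
        then show "edge_row p f \<in> range (\<lambda>l z. \<Sum>f\<in>F. l f *\<^sub>R edge_row p f z)"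
          by (rule range_eqI[of _ _ "\<lambda>g. if g = f then 1 else 0"])
      qed
      show "row_space.subspace (range (\<lambda>l z. \<Sum>f\<in>F. l f *\<^sub>R edge_row p f z))"
      proof (rule row_space.subspaceI)
        show "0 \<in> range (\<lambda>l z. \<Sum>f\<in>F. l f *\<^sub>R edge_row p f z)"
          by (rule range_eqI[of _ _ "\<lambda>_. 0"]) (auto simp: fun_eq_iff)
      next
        fix x y assume "x \<in> range (\<lambda>l z. \<Sum>f\<in>F. l f *\<^sub>R edge_row p f z)"
          "y \<in> range (\<lambda>l z. \<Sum>f\<in>F. l f *\<^sub>R edge_row p f z)"
        then obtain l k where "x = (\<lambda>z. \<Sum>f\<in>F. l f *\<^sub>R edge_row p f z)"
          "y = (\<lambda>z. \<Sum>f\<in>F. k f *\<^sub>R edge_row p f z)" by blast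
        then show "x + y \<in> range (\<lambda>l z. \<Sum>f\<in>F. l f *\<^sub>R edge_row p f z)"
          by (intro range_eqI[of _ _ "\<lambda>f. l f + k f"]) (simp add: fun_eq_iff scaleR_add_left sum.distrib)
      next
        fix c x assume "x \<in> range (\<lambda>l z. \<Sum>f\<in>F. l f *\<^sub>R edge_row p f z)"
        then obtain l where "x = (\<lambda>z. \<Sum>f\<in>F. l f *\<^sub>R edge_row p f z)" by blast
        then show "(\<lambda>v. c *\<^sub>R x v) \<in> range (\<lambda>l z. \<Sum>f\<in>F. l f *\<^sub>R edge_row p f z)"
          by (intro range_eqI[of _ _ "\<lambda>f. c * l f"]) (simp add: fun_eq_iff scaleR_sum_right)
      qed
    qed
    moreover assume "edge_row p e \<in> row_space.span (edge_row p ` F)"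
    ultimately obtain l where l: "edge_row p e = (\<lambda>z. \<Sum>f\<in>F. l f *\<^sub>R edge_row p f z)" by blast
    have "(\<Sum>f\<in>insert e F. (if f = e then - 1 else l f) *\<^sub>R edge_row p f z) = 0" for z
    proof -
      have "(\<Sum>f\<in>F. (if f = e then - 1 else l f) *\<^sub>R edge_row p f z) = (\<Sum>f\<in>F. l f *\<^sub>R edge_row p f z)"
        using F by (intro sum.cong) auto
      then show ?thesis using F fun_cong[OF l, of z] by simp
    qed
    then have "\<forall>f\<in>insert e F. (if f = e then - 1 else l f) = 0"
      by (intro L[unfolded row_independent_def, THEN spec, THEN mp] allI)
    from bspec[OF this, of e] show False by simp
  qed
next
  assume R: "edge_row p e \<notin> row_space.span (edge_row p ` F)"
  show "row_independent p (insert e F)"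
    unfolding row_independent_def
  proof (intro allI impI)
    fix l assume l: "\<forall>z. (\<Sum>f\<in>insert e F. l f *\<^sub>R edge_row p f z) = 0"
    then have l': "l e *\<^sub>R edge_row p e z + (\<Sum>f\<in>F. l f *\<^sub>R edge_row p f z) = 0" for z
      using F by simp
    have "l e = 0"
    proof (rule ccontr)
      assume "l e \<noteq> 0"
      have "edge_row p e z = (\<Sum>f\<in>F. (- l f / l e) *\<^sub>R edge_row p f z)" for z
      proof -
        have "edge_row p e z = (- 1 / l e) *\<^sub>R (\<Sum>f\<in>F. l f *\<^sub>R edge_row p f z)"
          using l'[of z] \<open>l e \<noteq> 0\<close> by (simp add: add_eq_0_iff)
        then show ?thesis by (simp add: scaleR_sum_right sum_negf)
      qed
      then have "edge_row p e = (\<Sum>f\<in>F. (\<lambda>z. (- l f / l e) *\<^sub>R edge_row p f z))"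
        by (simp add: fun_eq_iff sum_fun_apply)
      moreover have "(\<Sum>f\<in>F. (\<lambda>z. (- l f / l e) *\<^sub>R edge_row p f z)) \<in> row_space.span (edge_row p ` F)"
        by (intro row_space.span_sum row_space.span_scale row_space.span_base) auto
      ultimately show False using R by simp
    qed
    then show "\<forall>f\<in>insert e F. l f = 0"
      using F(2) l' unfolding row_independent_def by simp
  qed
qed

lemma row_basis_exists:
  assumes "finite E"
  obtains F where "F \<subseteq> E" "row_independent p F" "edge_row p ` E \<subseteq> row_space.span (edge_row p ` F)"
proof -
  have "\<exists>F\<subseteq>E. row_independent p F \<and> edge_row p ` E \<subseteq> row_space.span (edge_row p ` F)"
    using assms
  proof (induction E)
    case empty
    then show ?case using row_independent_empty by auto
  next
    case (insert e E)
    then obtain F where F: "F \<subseteq> E" "row_independent p F" "edge_row p ` E \<subseteq> row_space.span (edge_row p ` F)"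
      by blast
    have "finite F" "e \<notin> F" using F insert.hyps finite_subset by auto
    show ?case
    proof (cases "edge_row p e \<in> row_space.span (edge_row p ` F)")
      case True
      then show ?thesis using F by (intro exI[of _ F]) auto
    next
      case False
      then have "row_independent p (insert e F)"
        using row_independent_insert[OF \<open>finite F\<close> F(2) \<open>e \<notin> F\<close>] by blast
      moreover have "edge_row p ` insert e E \<subseteq> row_space.span (edge_row p ` insert e F)"
        using F(3) row_space.span_mono[of "edge_row p ` F" "edge_row p ` insert e F"]
        by (auto intro: row_space.span_base)
      ultimately show ?thesis using F by (intro exI[of _ "insert e F"]) auto
    qed
  qed
  with that show ?thesis by blast
qed

text \<open>A row basis \<open>F\<close> at \<open>p\<close> stays independent at \<open>q\<close>
  by \<open>pq\<close>. Each further edge makes it dependent at \<open>p\<close>, hence at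
  \<open>q\<close> by the contrapositive of \<open>qp\<close>, so \<open>F\<close> spans all rows at
  \<open>q\<close> as well.\<close>

lemma inf_rigid_transfer:
  assumes V: "finite V" and E: "E \<subseteq> complete_edges V" and "inf_rigid V E p"
    and pq: "\<And>F. F \<subseteq> E \<Longrightarrow> row_independent p F \<Longrightarrow> row_independent q F"
    and qp: "\<And>F. F \<subseteq> complete_edges V \<Longrightarrow> row_independent q F \<Longrightarrow> row_independent p F"
  shows "inf_rigid V E q"
  unfolding inf_rigid_iff_span[OF V E]
proof clarify
  fix e assume e: "e \<in> complete_edges V"
  have "finite E" using finite_complete_edges[OF V] E finite_subset by blast
  then obtain F where F: "F \<subseteq> E" "row_independent p F" "edge_row p ` E \<subseteq> row_space.span (edge_row p ` F)"
    using row_basis_exists by blast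
  have "finite F" using F \<open>finite E\<close> finite_subset by blast
  have "edge_row p ` complete_edges V \<subseteq> row_space.span (edge_row p ` F)"
    using assms(3) F(3) row_space.span_minimal[OF F(3) row_space.subspace_span]
    unfolding inf_rigid_iff_span[OF V E] by blast
  then have "\<not> row_independent p (insert e F)" if "e \<notin> F"
    using row_independent_insert[OF \<open>finite F\<close> F(2) that] e by blast
  then have "\<not> row_independent q (insert e F)" if "e \<notin> F"
    using qp[of "insert e F"] that e F(1) E by blast
  then have "edge_row q e \<in> row_space.span (edge_row q ` F)"
    using row_independent_insert[OF \<open>finite F\<close> pq[OF F(1,2)]]
    by (cases "e \<in> F") (auto intro: row_space.span_base)
  then show "edge_row q e \<in> row_space.span (edge_row q ` E)"
    using row_space.span_mono[of "edge_row q ` F" "edge_row q ` E"] F(1) by blast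
qed

text \<open>The row entries are rational polynomials in the coordinates, so elimination carries
  independence from any placement to a generic one.\<close>

lemma row_independent_generic:
  fixes p q :: "'v \<Rightarrow> real ^ 'd"
  assumes p: "generic V p" and V: "finite V" and F: "F \<subseteq> complete_edges V" and q: "row_independent q F"
  shows "row_independent p F"
  unfolding row_independent_def
proof (intro allI impI)
  fix l assume l: "\<forall>z. (\<Sum>e\<in>F. l e *\<^sub>R edge_row p e z) = 0"
  define f :: "'v set \<Rightarrow> 'v \<times> 'd \<Rightarrow> ('v \<times> 'd \<Rightarrow> real) \<Rightarrow> real"
    where "f e = (\<lambda>(z, i) a. if z \<in> e then \<Sum>y\<in>e. a (z, i) - a (y, i) else 0)" for e
  have f: "edge_row r e z $ i = f e (z, i) (\<lambda>(v, i). r v $ i)" for r e z i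
    by (simp add: f_def edge_row_def)
  have coord: "(\<forall>z. (\<Sum>e\<in>F. k e *\<^sub>R edge_row r e z) = 0) \<longleftrightarrow>
      (\<forall>j. (\<Sum>e\<in>F. k e * f e j (\<lambda>(v, i). r v $ i)) = 0)" for r k
    by (simp add: vec_eq_iff f)
  show "\<forall>e\<in>F. l e = 0"
  proof (rule rat_polyfuns_independent[of "V \<times> UNIV" "\<lambda>(v, i). p v $ i" F f "\<lambda>(v, i). q v $ i"])
    show "alg_independent_rat (V \<times> UNIV) (\<lambda>(v, i). p v $ i)"
      using p by (simp add: generic_def)
    show "finite F" using finite_complete_edges[OF V] F finite_subset by blast
    show "f e j \<in> rat_polyfuns (V \<times> UNIV)" if "e \<in> F" for e j
    proof -
      obtain z i where j: "j = (z, i)" by force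
      show ?thesis
      proof (cases "z \<in> e")
        case True
        have "e \<subseteq> V" using F that by (auto simp: complete_edges_def)
        then have "(\<lambda>a. \<Sum>y\<in>e. a (z, i) - a (y, i)) \<in> rat_polyfuns (V \<times> UNIV)"
          using True by (intro rat_polyfuns_sum rat_polyfuns_diff rat_polyfuns_var) auto
        then show ?thesis using True by (simp add: f_def j)
      next
        case False
        then show ?thesis using rat_polyfuns_const[of 0] by (simp add: f_def j)
      qed
    qed
    show "\<forall>e\<in>F. k e = 0" if "\<And>j. (\<Sum>e\<in>F. k e * f e j (\<lambda>(v, i). q v $ i)) = 0" for k
      using q that unfolding row_independent_def coord by blast
    show "(\<Sum>e\<in>F. l e * f e j (\<lambda>(v, i). p v $ i)) = 0" for j
      using l unfolding coord by blast
  qed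
qed

lemma span_of_equal_dim:
  assumes "finite T" "S \<subseteq> T" "row_space.dim S = row_space.dim T"
  shows "T \<subseteq> row_space.span S"
proof (rule ccontr)
  assume "\<not> T \<subseteq> row_space.span S"
  then obtain t where t: "t \<in> T" "t \<notin> row_space.span S" by blast
  obtain B where B: "B \<subseteq> S" "row_space.independent B" "S \<subseteq> row_space.span B" "card B = row_space.dim S"
    using row_space.basis_exists by blast
  obtain C where C: "C \<subseteq> T" "row_space.independent C" "T \<subseteq> row_space.span C" "card C = row_space.dim T"
    using row_space.basis_exists by blast
  have fin: "finite B" "finite C" using assms B C by (meson finite_subset)+
  have t': "t \<notin> row_space.span B" using t B(1) row_space.span_mono by blast
  then have "row_space.independent (insert t B)" using B(2) by (rule row_space.independent_insertI)
  moreover have "insert t B \<subseteq> row_space.span C" using B(1) assms(2) C(3) t(1) by blast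
  ultimately have "card (insert t B) \<le> card C"
    using row_space.independent_span_bound[OF fin(2)] by blast
  moreover have "t \<notin> B" using t' row_space.span_base by blast
  ultimately show False using B(4) C(4) assms(3) fin by simp
qed

text \<open>The rank in \<open>rigid\<close> is taken at the chosen placement \<open>p0\<close>.
  Equal rank there gives equal row spans, and any two generic placements have the same independent
  edge sets.\<close>

lemma rigid_imp_inf_rigid:
  fixes p :: "'v \<Rightarrow> real ^ 'd"
  assumes G: "simple_graph V E" and rigid: "rigid TYPE('d) V E" and p: "generic V p"
  shows "inf_rigid V E p"
proof -
  have V: "finite V" and E: "E \<subseteq> complete_edges V" using G by (auto simp: simple_graph_def)
  define p0 where "p0 = (SOME p :: 'v \<Rightarrow> real ^ 'd. generic V p)"
  have p0: "generic V p0" unfolding p0_def by (rule someI[of "generic V", OF p])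
  have "row_space.dim (edge_row p0 ` E) = row_space.dim (edge_row p0 ` complete_edges V)"
    using rigid rigidity_rows_eq[OF E, of p0] rigidity_rows_eq[OF order_refl, of V p0]
    by (simp add: rigid_def generic_rank_def rigidity_rank_def p0_def)
  then have "edge_row p0 ` complete_edges V \<subseteq> row_space.span (edge_row p0 ` E)"
    using finite_complete_edges[OF V] E by (intro span_of_equal_dim) auto
  then have "inf_rigid V E p0" using inf_rigid_iff_span[OF V E] by blast
  then show ?thesis
    by (rule inf_rigid_transfer[OF V E]) (use row_independent_generic p p0 V E in blast)+
qed

section \<open>Rigidity matrices of equivalent frameworks\<close>

definition equivalent_frameworks :: "'v set set \<Rightarrow> ('v \<Rightarrow> real ^ 'd) \<Rightarrow> ('v \<Rightarrow> real ^ 'd) \<Rightarrow> bool" where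
  "equivalent_frameworks E p q \<longleftrightarrow> (\<forall>x y. {x, y} \<in> E \<longrightarrow> norm (p x - p y) = norm (q x - q y))"

lemma equivalent_frameworks_derivation:
  assumes "real_derivation D" "equivalent_frameworks E p q" "{x, y} \<in> E"
  shows "(p x - p y) \<bullet> (derivation_vec D (p x) - derivation_vec D (p y)) =
    (q x - q y) \<bullet> (derivation_vec D (q x) - derivation_vec D (q y))"
proof -
  have "(p x - p y) \<bullet> (p x - p y) = (q x - q y) \<bullet> (q x - q y)"
    using assms(2,3) by (simp add: equivalent_frameworks_def dot_square_norm)
  then have "D ((p x - p y) \<bullet> (p x - p y)) = D ((q x - q y) \<bullet> (q x - q y))" by simp
  then show ?thesis
    by (simp add: derivation_inner[OF assms(1)] derivation_vec_diff[OF assms(1)] inner_commute)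
qed

text \<open>
  Every equilibrium stress \<open>l\<close> of \<open>q\<close> is one of \<open>p\<close>: \<open>l\<close> annihilates \<open>R(q) (D q) = R(p) (D p)\<close>,
  and \<open>D p\<close> is arbitrary.
\<close>

lemma row_independent_equivalent:
  fixes p q :: "'v \<Rightarrow> real ^ 'd"
  assumes p: "generic V p" and V: "finite V" and F: "F \<subseteq> complete_edges V"
    and eq: "equivalent_frameworks F p q" and ind: "row_independent p F"
  shows "row_independent q F"
  unfolding row_independent_def
proof (intro allI impI)
  fix l assume l: "\<forall>z. (\<Sum>e\<in>F. l e *\<^sub>R edge_row q e z) = 0"
  have pairing: "(\<Sum>e\<in>F. l e * row_pairing V (edge_row r e) m) =
      (\<Sum>z\<in>V. (\<Sum>e\<in>F. l e *\<^sub>R edge_row r e z) \<bullet> m z)" for r m :: "'v \<Rightarrow> real ^ 'd"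
    by (simp add: row_pairing_def sum_distrib_left inner_sum_left sum.swap[of _ F])
  have "(\<Sum>e\<in>F. l e *\<^sub>R edge_row p e z) = 0" for z
  proof (cases "z \<in> V")
    case True
    \<comment> \<open>The resultant of \<open>l\<close> at \<open>z\<close>. Moving only
      \<open>z\<close>, in the direction \<open>w\<close>, turns the vanishing total pairing into
      \<open>w \<bullet> w = 0\<close>.\<close>
    define w where "w = (\<Sum>e\<in>F. l e *\<^sub>R edge_row p e z)"
    define c where "c v = (if v = z then w else 0)" for v
    obtain D where D: "real_derivation D" "\<And>v. v \<in> V \<Longrightarrow> derivation_vec D (p v) = c v"
      using generic_exists_derivation[OF p] by blast
    have "row_pairing V (edge_row p e) c = row_pairing V (edge_row q e) (\<lambda>v. derivation_vec D (q v))"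
      if e: "e \<in> F" for e
    proof -
      obtain x y where xy: "e = {x, y}" "x \<in> V" "y \<in> V" "x \<noteq> y"
        using e F by (meson complete_edgesE subsetD)
      then show ?thesis
        using equivalent_frameworks_derivation[OF D(1) eq, of x y] e
        by (simp add: row_pairing_edge_row[OF V] D(2))
    qed
    then have "(\<Sum>e\<in>F. l e * row_pairing V (edge_row p e) c) =
        (\<Sum>e\<in>F. l e * row_pairing V (edge_row q e) (\<lambda>v. derivation_vec D (q v)))"
      by simp
    also have "\<dots> = 0" using l by (simp add: pairing)
    finally have "(\<Sum>v\<in>V. (\<Sum>e\<in>F. l e *\<^sub>R edge_row p e v) \<bullet> c v) = 0" by (simp add: pairing)
    then have "w \<bullet> w = 0"
      using V True by (simp add: c_def if_distrib[of "inner _"] w_def[symmetric] cong: if_cong)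
    then show ?thesis by (simp add: w_def)
  next
    case False
    then show ?thesis using F by (intro sum.neutral) (auto simp: edge_row_def complete_edges_def)
  qed
  then show "\<forall>e\<in>F. l e = 0" using ind unfolding row_independent_def by blast
qed

text \<open>Derivations carry independence of subsets of \<open>E\<close> from \<open>p\<close> to
  \<open>q\<close>; genericity of \<open>p\<close> carries it back for all edge sets.\<close>

lemma inf_rigid_equivalent:
  assumes "generic V p" and V: "finite V" and E: "E \<subseteq> complete_edges V"
    and "inf_rigid V E p" "equivalent_frameworks E p q"
  shows "inf_rigid V E q"
proof (rule inf_rigid_transfer[OF V E assms(4)])
  fix F assume F: "F \<subseteq> E" "row_independent p F"
  then have "equivalent_frameworks F p q"
    using assms(5) by (auto simp: equivalent_frameworks_def)
  with F E show "row_independent q F"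
    using row_independent_equivalent[OF assms(1) V, of F q] by blast
next
  fix F assume "F \<subseteq> complete_edges V" "row_independent q F"
  then show "row_independent p F" by (rule row_independent_generic[OF assms(1) V])
qed

section \<open>Generic points in general position\<close>

definition independent_family :: "'t set \<Rightarrow> ('t \<Rightarrow> 'a::real_vector) \<Rightarrow> bool" where
  "independent_family T a \<longleftrightarrow> (\<forall>l. (\<Sum>t\<in>T. l t *\<^sub>R a t) = 0 \<longrightarrow> (\<forall>t\<in>T. l t = 0))"

lemma independent_familyD:
  "independent_family T a \<Longrightarrow> (\<Sum>t\<in>T. l t *\<^sub>R a t) = 0 \<Longrightarrow> t \<in> T \<Longrightarrow> l t = 0"
  by (auto simp: independent_family_def)

lemma independent_family_inj_on:
  assumes "finite T" "independent_family T a"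
  shows "inj_on a T"
proof (rule inj_onI, rule ccontr)
  fix s t assume st: "s \<in> T" "t \<in> T" "a s = a t" "s \<noteq> t"
  define l where "l x = (if x = s then 1 else if x = t then - 1 else 0 :: real)" for x
  have "(\<Sum>x\<in>T. l x *\<^sub>R a x) = (\<Sum>x\<in>{s, t}. l x *\<^sub>R a x)"
    using assms(1) st by (intro sum.mono_neutral_right) (auto simp: l_def)
  also have "\<dots> = 0" using st by (simp add: l_def)
  finally have "l s = 0" using independent_familyD[OF assms(2)] st(1) by blast
  then show False by (simp add: l_def)
qed

lemma independent_family_independent:
  assumes "finite T" "independent_family T a"
  shows "independent (a ` T)"
proof (rule independent_if_scalars_zero)
  show "finite (a ` T)" using assms(1) by simp
  fix f x assume f: "(\<Sum>x\<in>a ` T. f x *\<^sub>R x) = 0" and "x \<in> a ` T"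
  then obtain t where t: "t \<in> T" "x = a t" by blast
  have "(\<Sum>t\<in>T. f (a t) *\<^sub>R a t) = 0"
    using f sum.reindex[OF independent_family_inj_on[OF assms], of "\<lambda>x. f x *\<^sub>R x"] by simp
  from independent_familyD[OF assms(2) this t(1)] show "f x = 0" by (simp add: t)
qed

lemma independent_family_spans:
  fixes a :: "'t \<Rightarrow> 'a::euclidean_space"
  assumes T: "finite T" "independent_family T a" and card: "card T = DIM('a)"
  obtains h where "x = (\<Sum>t\<in>T. h t *\<^sub>R a t)"
proof -
  have "card (a ` T) = DIM('a)"
    using card card_image[OF independent_family_inj_on[OF T]] by simp
  then have "dim (a ` T) = DIM('a)"
    using dim_eq_card_independent[OF independent_family_independent[OF T]] by simp
  then have "x \<in> span (a ` T)" using dim_eq_full by blast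
  then obtain u where "(\<Sum>y\<in>a ` T. u y *\<^sub>R y) = x" using span_finite[of "a ` T"] T(1) by auto
  then have "x = (\<Sum>t\<in>T. u (a t) *\<^sub>R a t)"
    using sum.reindex[OF independent_family_inj_on[OF T], of "\<lambda>x. u x *\<^sub>R x"] by simp
  then show ?thesis by (rule that)
qed

lemma independent_family_orthogonal:
  fixes a :: "'t \<Rightarrow> 'a::euclidean_space"
  assumes T: "finite T" "independent_family T a" "card T = DIM('a)" and x: "\<And>t. t \<in> T \<Longrightarrow> x \<bullet> a t = 0"
  shows "x = 0"
proof -
  obtain h where h: "x = (\<Sum>t\<in>T. h t *\<^sub>R a t)" using independent_family_spans[OF T] by blast
  have "x \<bullet> x = (\<Sum>t\<in>T. h t * (x \<bullet> a t))" by (subst (2) h) (simp add: inner_sum_right)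
  then show ?thesis using x by simp
qed

text \<open>Independence allows a linear functional with the prescribed values; its adjoint at
  \<open>1\<close> is the vector that represents it.\<close>

lemma independent_family_solve:
  fixes a :: "'t \<Rightarrow> 'a::euclidean_space"
  assumes T: "finite T" "independent_family T a"
  obtains x where "\<And>t. t \<in> T \<Longrightarrow> a t \<bullet> x = b t"
proof -
  have inj: "inj_on a T" by (rule independent_family_inj_on[OF T])
  obtain f :: "'a \<Rightarrow> real" where f: "linear f" "\<And>y. y \<in> a ` T \<Longrightarrow> f y = b (the_inv_into T a y)"
    using linear_independent_extend[OF independent_family_independent[OF T],
        of "\<lambda>y. b (the_inv_into T a y)"] by auto
  have "a t \<bullet> adjoint f 1 = b t" if "t \<in> T" for t
    using adjoint_works[OF f(1), of "a t" 1] f(2) that by (simp add: inner_commute the_inv_into_f_f[OF inj])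
  then show ?thesis by (rule that)
qed

lemma orthogonal_to_few:
  fixes a :: "'t \<Rightarrow> 'a::euclidean_space"
  assumes "finite T" "card T < DIM('a)"
  obtains n where "n \<noteq> 0" "\<And>y. y \<in> span (a ` T) \<Longrightarrow> n \<bullet> y = 0"
proof -
  have "dim (a ` T) < DIM('a)"
    using assms dim_le_card'[of "a ` T"] card_image_le[of T a] by simp
  then obtain n where "n \<noteq> 0" "\<And>y. y \<in> span (a ` T) \<Longrightarrow> orthogonal n y"
    using orthogonal_to_subspace_exists by blast
  with that show ?thesis by (simp add: orthogonal_def)
qed

text \<open>
  A linear relation \<open>l\<close> of at most \<open>d\<close> vectors comes with a common normal \<open>n\<close>. Applying a
  derivation with \<open>D (p t) = n\<close> for one \<open>t\<close> to the orthogonality relations and pairing with \<open>l\<close>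
  leaves \<open>l t * (n \<bullet> n) = 0\<close>.
\<close>

lemma generic_independent_family:
  fixes p :: "'v \<Rightarrow> real ^ 'd"
  assumes p: "generic V p" and u: "u \<in> V" and T: "finite T" "T \<subseteq> V - {u}" "card T \<le> CARD('d)"
  shows "independent_family T (\<lambda>t. p t - p u)"
  unfolding independent_family_def
proof (intro allI impI ballI, rule ccontr)
  fix l t assume l: "(\<Sum>t\<in>T. l t *\<^sub>R (p t - p u)) = 0" and t: "t \<in> T" "l t \<noteq> 0"
  define a where "a t = p t - p u" for t
  have rel: "(\<Sum>s\<in>T. l s *\<^sub>R a s) = 0" using l by (simp add: a_def)
  have "card (T - {t}) < card T" using T t by (intro psubset_card_mono) auto
  then have "card (T - {t}) < DIM(real ^ 'd)" using T by simp
  then obtain n where n: "n \<noteq> 0" "\<And>y. y \<in> span (a ` (T - {t})) \<Longrightarrow> n \<bullet> y = 0"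
    using orthogonal_to_few[of "T - {t}" a] T(1) by auto
  have n': "n \<bullet> a s = 0" if "s \<in> T - {t}" for s
    using n(2) that by (simp add: span_base)
  have "0 = n \<bullet> (\<Sum>s\<in>T. l s *\<^sub>R a s)" by (simp add: rel)
  also have "\<dots> = (\<Sum>s\<in>T. l s * (n \<bullet> a s))" by (simp add: inner_sum_right)
  \<comment> \<open>The other vectors are orthogonal to \<open>n\<close>, so the relation forces
    \<open>a t\<close> to be orthogonal to \<open>n\<close> too.\<close>
  also have "\<dots> = l t * (n \<bullet> a t)"
    using T(1) t(1) n' by (simp add: sum.remove)
  finally have "n \<bullet> a s = 0" if "s \<in> T" for s using n' t(2) that by (cases "s = t") auto
  moreover obtain D where D: "real_derivation D"
      "\<And>v. v \<in> V \<Longrightarrow> derivation_vec D (p v) = (if v = t then n else 0)"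
    using generic_exists_derivation[OF p, of "\<lambda>v. if v = t then n else 0"] by blast
  ultimately have "derivation_vec D n \<bullet> a s + n \<bullet> derivation_vec D (a s) = 0" if "s \<in> T" for s
    using derivation_inner[OF D(1), of n "a s"] that by (simp add: derivation_0[OF D(1)])
  then have "(\<Sum>s\<in>T. l s * (derivation_vec D n \<bullet> a s + n \<bullet> derivation_vec D (a s))) = 0"
    by simp
  moreover have "(\<Sum>s\<in>T. l s * (derivation_vec D n \<bullet> a s)) = derivation_vec D n \<bullet> (\<Sum>s\<in>T. l s *\<^sub>R a s)"
    by (simp add: inner_sum_right)
  ultimately have "(\<Sum>s\<in>T. l s * (n \<bullet> derivation_vec D (a s))) = 0"
    by (simp add: rel distrib_left sum.distrib)
  moreover have "derivation_vec D (a s) = (if s = t then n else 0)" if "s \<in> T" for s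
    using T(2) that t(1) u D(2) by (auto simp: a_def derivation_vec_diff[OF D(1)])
  ultimately have "l t * (n \<bullet> n) = 0"
    using T(1) t(1) by (simp add: if_distrib[of "inner _"] if_distrib[of "(*) _"] cong: if_cong)
  then show False using n(1) t(2) by simp
qed

section \<open>Neighbourhoods in infinitesimally rigid frameworks\<close>

definition neighbours :: "'v set set \<Rightarrow> 'v \<Rightarrow> 'v set" where
  "neighbours E v = {u. {u, v} \<in> E}"

lemma neighbours_subset: "E \<subseteq> complete_edges V \<Longrightarrow> neighbours E v \<subseteq> V - {v}"
proof
  fix u assume "E \<subseteq> complete_edges V" "u \<in> neighbours E v"
  then have "{u, v} \<in> complete_edges V" unfolding neighbours_def by blast
  then show "u \<in> V - {v}" by (simp add: complete_edges_iff)
qed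

text \<open>With fewer than \<open>d\<close> neighbours, some \<open>n\<close> is normal to all
  edges at \<open>v\<close>, and moving \<open>v\<close> alone along \<open>n\<close> is a motion.
  Rigidity makes \<open>n\<close> orthogonal to \<open>d\<close> independent vectors, hence
  zero.\<close>

lemma inf_rigid_degree:
  fixes p :: "'v \<Rightarrow> real ^ 'd"
  assumes p: "generic V p" and V: "finite V" and E: "E \<subseteq> complete_edges V" and "inf_rigid V E p"
    and v: "v \<in> V" and card: "card V \<ge> CARD('d) + 1"
  shows "card (neighbours E v) \<ge> CARD('d)"
proof (rule ccontr)
  assume "\<not> ?thesis"
  then have "card (neighbours E v) < DIM(real ^ 'd)" by simp
  moreover have "finite (neighbours E v)" using neighbours_subset[OF E] V finite_subset by blast
  ultimately obtain n where n: "n \<noteq> 0" "\<And>y. y \<in> span ((\<lambda>u. p u - p v) ` neighbours E v) \<Longrightarrow> n \<bullet> y = 0"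
    using orthogonal_to_few by metis
  then have nbr: "n \<bullet> (p u - p v) = 0" if "{u, v} \<in> E" for u
    using that by (simp add: span_base neighbours_def)
  define m where "m z = (if z = v then n else 0)" for z
  have "infinitesimal_motion E p m"
    unfolding infinitesimal_motion_def
  proof (intro allI impI)
    fix x y assume "{x, y} \<in> E"
    then show "(p x - p y) \<bullet> (m x - m y) = 0"
      using nbr[of x] nbr[of y] by (auto simp: m_def inner_commute insert_commute inner_diff_left inner_diff_right)
  qed
  then have m: "infinitesimal_motion (complete_edges V) p m"
    using assms(4) by (simp add: inf_rigid_def)
  have orth: "n \<bullet> (p u - p v) = 0" if "u \<in> V - {v}" for u
  proof -
    have "{u, v} \<in> complete_edges V" using that v by (simp add: complete_edges_iff)
    then have "(p u - p v) \<bullet> (m u - m v) = 0" using m unfolding infinitesimal_motion_def by blast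
    then show ?thesis using that by (simp add: m_def inner_commute)
  qed
  have "CARD('d) \<le> card (V - {v})" using card v V by simp
  then obtain T where T: "T \<subseteq> V - {v}" "card T = CARD('d)" "finite T"
    using obtain_subset_with_card_n by blast
  have "n = 0"
  proof (rule independent_family_orthogonal[OF T(3)])
    show "independent_family T (\<lambda>t. p t - p v)"
      using generic_independent_family[OF p v T(3,1)] T(2) by simp
  qed (use T orth in auto)
  then show False using n(1) by simp
qed

text \<open>The affine dependency \<open>l\<close> of the points yields the stress \<open>l x * l y\<close> of the complete graph.\<close>

lemma missing_edge_motion:
  fixes p m :: "'v \<Rightarrow> 'a::real_inner"
  assumes W: "finite W" and vw: "v \<in> W" "w \<in> W" "v \<noteq> w" "l v \<noteq> 0" "l w \<noteq> 0"
    and l: "(\<Sum>x\<in>W. l x) = 0" "(\<Sum>x\<in>W. l x *\<^sub>R p x) = 0"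
    and m: "\<And>x y. x \<in> W \<Longrightarrow> y \<in> W \<Longrightarrow> {x, y} \<noteq> {v, w} \<Longrightarrow> (p x - p y) \<bullet> (m x - m y) = 0"
  shows "(p v - p w) \<bullet> (m v - m w) = 0"
proof -
  \<comment> \<open>The weighted sum of all edge terms splits into four double sums: the sums over
    equal indices vanish because the coefficients \<open>l\<close> add up to zero, the mixed ones by
    the relation for \<open>p\<close>.\<close>
  define g where "g x y = l x * l y * ((p x - p y) \<bullet> (m x - m y))" for x y
  have 1: "(\<Sum>x\<in>W. \<Sum>y\<in>W. l x * l y * (p x \<bullet> m x)) = 0"
    by (simp add: sum_distrib_left[symmetric] sum_distrib_right[symmetric] l(1))
  have "(\<Sum>x\<in>W. \<Sum>y\<in>W. l x * l y * (p x \<bullet> m y)) = (\<Sum>x\<in>W. l x *\<^sub>R p x) \<bullet> (\<Sum>y\<in>W. l y *\<^sub>R m y)"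
    by (subst sum.swap) (simp add: inner_sum_left inner_sum_right sum_distrib_left mult_ac)
  then have 2: "(\<Sum>x\<in>W. \<Sum>y\<in>W. l x * l y * (p x \<bullet> m y)) = 0" by (simp add: l(2))
  have 3: "(\<Sum>x\<in>W. \<Sum>y\<in>W. l x * l y * (p y \<bullet> m y)) = 0"
    using 1 by (subst sum.swap) (simp add: mult_ac)
  have 4: "(\<Sum>x\<in>W. \<Sum>y\<in>W. l x * l y * (p y \<bullet> m x)) = 0"
    using 2 by (subst sum.swap) (simp add: mult_ac)
  have "(\<Sum>x\<in>W. \<Sum>y\<in>W. g x y) =
      (\<Sum>x\<in>W. \<Sum>y\<in>W. l x * l y * (p x \<bullet> m x)) - (\<Sum>x\<in>W. \<Sum>y\<in>W. l x * l y * (p x \<bullet> m y))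
      + (\<Sum>x\<in>W. \<Sum>y\<in>W. l x * l y * (p y \<bullet> m y)) - (\<Sum>x\<in>W. \<Sum>y\<in>W. l x * l y * (p y \<bullet> m x))"
    unfolding g_def sum_subtractf[symmetric] sum.distrib[symmetric]
    by (intro sum.cong refl) (simp add: inner_diff_left inner_diff_right algebra_simps)
  then have "(\<Sum>x\<in>W. \<Sum>y\<in>W. g x y) = 0" by (simp only: 1 2 3 4)
  then have "(\<Sum>(x, y)\<in>W \<times> W. g x y) = 0" by (simp add: sum.cartesian_product)
  moreover have g0: "g x y = 0" if "x \<in> W" "y \<in> W" "(x, y) \<notin> {(v, w), (w, v)}" for x y
    using m[OF that(1,2)] that(3) by (auto simp: g_def doubleton_eq_iff)
  have "(\<Sum>(x, y)\<in>W \<times> W. g x y) = (\<Sum>(x, y)\<in>{(v, w), (w, v)}. g x y)"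
    using W vw(1,2) g0 by (intro sum.mono_neutral_right) auto
  moreover have "g w v = g v w" by (simp add: g_def inner_diff_left inner_diff_right algebra_simps)
  ultimately have "g v w = 0" using vw(3) by simp
  then show ?thesis using vw by (simp add: g_def)
qed

text \<open>A motion of the reduced graph extends to \<open>v\<close>: the equations of
  \<open>d\<close> edges at \<open>v\<close> determine its velocity, and every other edge at
  \<open>v\<close> completes a clique on \<open>d + 2\<close> points, whose affine dependency
  supplies the missing equation. The result is a motion of \<open>E\<close>.\<close>

lemma inf_rigid_neighbour_clique:
  fixes p :: "'v \<Rightarrow> real ^ 'd"
  assumes p: "generic V p" and V: "finite V" and E: "E \<subseteq> complete_edges V" and rigid: "inf_rigid V E p"
    and v: "v \<in> V" and card: "card (neighbours E v) \<ge> CARD('d)"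
  shows "inf_rigid (V - {v}) (delete_vertex_edges v E \<union> complete_edges (neighbours E v)) p"
  unfolding inf_rigid_def
proof (intro allI impI)
  fix m assume m: "infinitesimal_motion (delete_vertex_edges v E \<union> complete_edges (neighbours E v)) p m"
  define N where "N = neighbours E v"
  have N: "N \<subseteq> V - {v}" unfolding N_def by (rule neighbours_subset[OF E])
  have mN: "(p x - p y) \<bullet> (m x - m y) = 0" if "x \<in> N" "y \<in> N" for x y
    using m that unfolding infinitesimal_motion_def N_def
    by (cases "x = y") (auto simp: complete_edges_iff)
  obtain T where T: "T \<subseteq> N" "card T = CARD('d)" "finite T"
    using obtain_subset_with_card_n card unfolding N_def by blast
  have ind: "independent_family T (\<lambda>t. p t - p v)"
    using T N by (intro generic_independent_family[OF p v]) auto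
  obtain x where x: "\<And>t. t \<in> T \<Longrightarrow> (p t - p v) \<bullet> x = (p t - p v) \<bullet> m t"
    using independent_family_solve[OF T(3) ind, of "\<lambda>t. (p t - p v) \<bullet> m t"] by blast
  define m' where "m' = m(v := x)"
  have m'N: "m' y = m y" if "y \<in> N" for y using N that by (auto simp: m'_def)
  have m'T: "(p t - p v) \<bullet> (m' t - m' v) = 0" if "t \<in> T" for t
    using x[OF that] m'N[of t] T that by (auto simp: m'_def inner_diff_right)
  have star: "(p v - p w) \<bullet> (m' v - m' w) = 0" if w: "w \<in> N" for w
  proof (cases "w \<in> T")
    case True
    then show ?thesis using m'T[of w] by (simp add: inner_diff_left inner_diff_right)
  next
    case False
    obtain h where h: "p w - p v = (\<Sum>t\<in>T. h t *\<^sub>R (p t - p v))"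
      using independent_family_spans[OF T(3) ind] T(2) by auto
    \<comment> \<open>The affine dependency of \<open>v\<close>, \<open>w\<close> and
      \<open>T\<close>, read off from the expansion of \<open>p w - p v\<close>; the coefficient at
      \<open>v\<close> makes the total zero.\<close>
    define l where "l y = (if y = w then 1 else if y = v then (\<Sum>t\<in>T. h t) - 1 else - h y)" for y
    define W where "W = insert v (insert w T)"
    have nin: "v \<notin> T" "w \<noteq> v" "w \<notin> T" using N T w False by auto
    have lT: "l t = - h t" if "t \<in> T" for t using that nin by (auto simp: l_def)
    have sums: "(\<Sum>y\<in>W. l y) = 0" "(\<Sum>y\<in>W. l y *\<^sub>R p y) = 0"
      using T(3) nin h
      by (simp_all add: W_def lT sum_negf l_def[of v] l_def[of w] scaleR_sum_left
          scaleR_diff_left scaleR_diff_right sum_subtractf algebra_simps)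
    \<comment> \<open>Otherwise \<open>p w\<close> lies in the affine hull of the \<open>d\<close>
      points of \<open>T\<close>, which genericity excludes.\<close>
    have lv: "l v \<noteq> 0"
    proof
      assume "l v = 0"
      then have h1: "(\<Sum>t\<in>T. h t) = 1" using nin by (simp add: l_def)
      have "(\<Sum>t\<in>T. h t *\<^sub>R (p t - p w)) = (\<Sum>t\<in>T. h t *\<^sub>R (p t - p v)) - (\<Sum>t\<in>T. h t) *\<^sub>R (p w - p v)"
        by (simp add: scaleR_sum_left sum_subtractf[symmetric] algebra_simps)
      then have rel: "(\<Sum>t\<in>T. h t *\<^sub>R (p t - p w)) = 0" using h h1 by simp
      have "independent_family T (\<lambda>t. p t - p w)"
        using T N w nin by (intro generic_independent_family[OF p]) auto
      then have "\<forall>t\<in>T. h t = 0" using rel unfolding independent_family_def by blast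
      then show False using h1 by simp
    qed
    show ?thesis
    proof (rule missing_edge_motion[of W v w l p m'])
      fix y z assume yz: "y \<in> W" "z \<in> W" "{y, z} \<noteq> {v, w}"
      have *: "(p y - p z) \<bullet> (m' y - m' z) = 0" if "y \<in> N" "z \<in> N" for y z
        using mN m'N that by simp
      have **: "(p v - p t) \<bullet> (m' v - m' t) = 0" if "t \<in> T" for t
        using m'T[OF that] by (simp add: inner_diff_left inner_diff_right)
      consider "y = z" | "y \<in> N" "z \<in> N" | "y = v" "z \<in> T" | "z = v" "y \<in> T"
        using yz T w by (auto simp: W_def)
      then show "(p y - p z) \<bullet> (m' y - m' z) = 0"
        using * ** m'T by cases auto
    qed (use T(3) sums nin lv in \<open>auto simp: W_def l_def[of w]\<close>)
  qed
  have "infinitesimal_motion E p m'"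
    unfolding infinitesimal_motion_def
  proof (intro allI impI)
    fix y z assume yz: "{y, z} \<in> E"
    consider "y = v" "z \<in> N" | "z = v" "y \<in> N" | "y \<noteq> v" "z \<noteq> v"
      using yz insert_commute[of y z "{}"] by (cases "y = v"; cases "z = v") (auto simp: N_def neighbours_def)
    then show "(p y - p z) \<bullet> (m' y - m' z) = 0"
    proof cases
      case 2
      then show ?thesis using star[of y] by (simp add: inner_diff_left inner_diff_right)
    next
      case 3
      then have "{y, z} \<in> delete_vertex_edges v E" using yz by (auto simp: delete_vertex_edges_def)
      then show ?thesis using 3 m by (auto simp: infinitesimal_motion_def m'_def)
    qed (use star in auto)
  qed
  then have "infinitesimal_motion (complete_edges V) p m'"
    using rigid by (simp add: inf_rigid_def)
  then show "infinitesimal_motion (complete_edges (V - {v})) p m"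
    by (auto simp: infinitesimal_motion_def complete_edges_iff m'_def split: if_splits)
qed

section \<open>Congruence of the neighbours of a vertex\<close>

lemma delete_vertex_edges_subset:
  assumes "E \<subseteq> complete_edges V"
  shows "delete_vertex_edges v E \<subseteq> complete_edges (V - {v})"
proof
  fix e assume e: "e \<in> delete_vertex_edges v E"
  then have "e \<in> complete_edges V" using assms by (auto simp: delete_vertex_edges_def)
  then obtain x y where "e = {x, y}" "x \<in> V" "y \<in> V" "x \<noteq> y" by (rule complete_edgesE)
  with e show "e \<in> complete_edges (V - {v})"
    by (auto simp: delete_vertex_edges_def complete_edges_iff)
qed

lemma equivalent_frameworks_inner:
  "equivalent_frameworks E p q \<Longrightarrow> {x, y} \<in> E \<Longrightarrow> (p x - p y) \<bullet> (p x - p y) = (q x - q y) \<bullet> (q x - q y)"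
  by (simp add: equivalent_frameworks_def dot_square_norm)

lemma inner_polarization:
  fixes x y x' y' :: "'a::real_inner"
  assumes "x \<bullet> x = x' \<bullet> x'" "y \<bullet> y = y' \<bullet> y'" "(x - y) \<bullet> (x - y) = (x' - y') \<bullet> (x' - y')"
  shows "x \<bullet> y = x' \<bullet> y'"
  using assms by (simp add: inner_diff_left inner_diff_right inner_commute)

text \<open>The setting for one vertex \<open>v\<close>: the neighbour \<open>u\<close> serves as
  origin, and the vectors from \<open>u\<close> to the \<open>d\<close> further neighbours
  \<open>T\<close> are to serve as bases at both \<open>p\<close> and \<open>q\<close>.\<close>

locale vertex_star =
  fixes V :: "'v set" and E :: "'v set set" and p q :: "'v \<Rightarrow> real ^ 'd" and v u :: 'v and T :: "'v set"
  assumes generic: "generic V p" and V: "finite V" and E: "E \<subseteq> complete_edges V" and v: "v \<in> V"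
    and rigid: "inf_rigid (V - {v}) (delete_vertex_edges v E) p"
    and equivalent: "equivalent_frameworks E p q"
    and u: "u \<in> neighbours E v" and T: "T \<subseteq> neighbours E v - {u}" "card T = CARD('d)"
begin

definition a where "a t = p t - p u"
definition b where "b t = q t - q u"

lemma in_V: "u \<in> V - {v}" "T \<subseteq> V - {v}" "u \<notin> T"
  using neighbours_subset[OF E, of v] u T by auto

lemma finite_T: "finite T"
  using in_V V finite_subset by blast

lemma independent_a: "independent_family T a"
  unfolding a_def[abs_def] using in_V finite_T T
  by (intro generic_independent_family[OF generic]) auto

lemma edge_inner: "t \<in> neighbours E v \<Longrightarrow> (p v - p t) \<bullet> (p v - p t) = (q v - q t) \<bullet> (q v - q t)"
  using equivalent_frameworks_inner[OF equivalent, of v t] by (simp add: neighbours_def insert_commute)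

text \<open>Subtracting the edge equations at \<open>u\<close> and \<open>t\<close> cancels the
  squared terms in the position of \<open>v\<close> and leaves an equation linear in it.\<close>

lemma inner_b:
  assumes t: "t \<in> T"
  shows "2 * ((q v - q u) \<bullet> b t) = 2 * ((p v - p u) \<bullet> a t) + b t \<bullet> b t - a t \<bullet> a t"
proof -
  have "(p v - p u - a t) \<bullet> (p v - p u - a t) = (q v - q u - b t) \<bullet> (q v - q u - b t)"
    using edge_inner[of t] t T by (auto simp: a_def b_def)
  then show ?thesis
    using edge_inner[OF u] by (simp add: inner_diff_left inner_diff_right inner_commute)
qed

text \<open>An algebraic form of differentiation with respect to the position of \<open>v\<close> in
  direction \<open>x\<close>.\<close>

definition moves :: "real ^ 'd \<Rightarrow> (real \<Rightarrow> real) \<Rightarrow> bool" where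
  "moves x D \<longleftrightarrow> real_derivation D \<and> (\<forall>w\<in>V - {v}. derivation_vec D (p w) = 0) \<and> derivation_vec D (p v) = x"

lemma moves_exists: "\<exists>D. moves x D"
proof -
  obtain D where D: "real_derivation D" "\<And>w. w \<in> V \<Longrightarrow> derivation_vec D (p w) = (if w = v then x else 0)"
    using generic_exists_derivation[OF generic, of "\<lambda>w. if w = v then x else 0"] by blast
  then have "moves x D" using v by (simp add: moves_def)
  then show ?thesis by blast
qed

context
  fixes x D assumes D: "moves x D"
begin

lemma moves_derivation: "real_derivation D"
  using D by (simp add: moves_def)

lemma moves_a: "t \<in> T \<Longrightarrow> derivation_vec D (a t) = 0"
  using D in_V by (auto simp: moves_def a_def derivation_vec_diff)

lemma moves_z: "derivation_vec D (p v - p u) = x"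
  using D in_V by (simp add: moves_def derivation_vec_diff)

text \<open>By rigidity of \<open>G - v\<close> at \<open>q\<close>, all distances of
  \<open>q\<close> on \<open>V - {v}\<close> are constant under \<open>D\<close>; polarization on
  \<open>s\<close>, \<open>t\<close>, \<open>u\<close> gives the inner products.\<close>

lemma gram_constant:
  assumes "s \<in> T" "t \<in> T"
  shows "D (b s \<bullet> b t) = 0"
proof -
  let ?W = "V - {v}" and ?E = "delete_vertex_edges v E" and ?m = "\<lambda>w. derivation_vec D (q w)"
  have W: "generic ?W p" "finite ?W" "?E \<subseteq> complete_edges ?W"
    using generic_subset[OF generic] V delete_vertex_edges_subset[OF E] by auto
  have eq: "equivalent_frameworks ?E p q"
    using equivalent by (auto simp: equivalent_frameworks_def delete_vertex_edges_def)
  have "infinitesimal_motion ?E q ?m"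
    unfolding infinitesimal_motion_def
  proof (intro allI impI)
    fix y z assume yz: "{y, z} \<in> ?E"
    then have "{y, z} \<in> complete_edges ?W" using W(3) by blast
    then have "y \<in> ?W" "z \<in> ?W" by (simp_all add: complete_edges_iff)
    then show "(q y - q z) \<bullet> (?m y - ?m z) = 0"
      using equivalent_frameworks_derivation[OF moves_derivation eq yz] D by (simp add: moves_def)
  qed
  then have "infinitesimal_motion (complete_edges ?W) q ?m"
    using inf_rigid_equivalent[OF W rigid eq] by (simp add: inf_rigid_def)
  then have orth: "(q y - q z) \<bullet> (?m y - ?m z) = 0" if "y \<in> ?W" "z \<in> ?W" for y z
    using that by (cases "y = z") (auto simp: infinitesimal_motion_def complete_edges_iff)
  let ?b' = "\<lambda>t. derivation_vec D (b t)"
  have b': "?b' t = ?m t - ?m u" for t by (simp add: b_def derivation_vec_diff[OF moves_derivation])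
  have 1: "b t \<bullet> ?b' t = 0" if "t \<in> T" for t
    unfolding b' unfolding b_def using orth[of t u] in_V that by blast
  have "(b s - b t) \<bullet> (?b' s - ?b' t) = (q s - q t) \<bullet> (?m s - ?m t)"
    unfolding b' by (simp add: b_def)
  also have "\<dots> = 0" using orth[of s t] in_V assms by blast
  finally have "b s \<bullet> ?b' t + b t \<bullet> ?b' s = 0"
    using 1[OF assms(1)] 1[OF assms(2)] by (simp add: inner_diff_left inner_diff_right)
  then show ?thesis by (simp add: derivation_inner[OF moves_derivation] inner_commute)
qed

text \<open>The squares of \<open>a t\<close> and \<open>b t\<close> in the linear equation are
  constants for \<open>D\<close>, so only the displacement of \<open>p v\<close>
  contributes.\<close>

lemma moves_inner_b:
  assumes "t \<in> T"
  shows "D ((q v - q u) \<bullet> b t) = x \<bullet> a t"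
proof -
  let ?w = "(q v - q u) \<bullet> b t" and ?z = "(p v - p u) \<bullet> a t"
  have "?w + ?w = ?z + ?z + b t \<bullet> b t - a t \<bullet> a t" using inner_b[OF assms] by simp
  then have "D ?w + D ?w = D ?z + D ?z + D (b t \<bullet> b t) - D (a t \<bullet> a t)"
    by (metis derivation_add[OF moves_derivation] derivation_diff[OF moves_derivation])
  moreover have "D (a t \<bullet> a t) = 0" "D ?z = x \<bullet> a t"
    by (simp_all add: derivation_inner[OF moves_derivation] moves_a[OF assms] moves_z)
  ultimately show ?thesis using gram_constant[OF assms assms] by simp
qed

end

text \<open>
  A relation of least support, normalised at \<open>i\<close>, has constant coefficients, since differentiating
  it gives a relation of smaller support. Differentiating its pairing with \<open>q v - q u\<close> then yields
  the same relation for \<open>a\<close>.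
\<close>

lemma independent_b: "independent_family T b"
proof (rule ccontr)
  define P where "P n \<longleftrightarrow> (\<exists>l. (\<Sum>t\<in>T. l t *\<^sub>R b t) = 0 \<and> card {t\<in>T. l t \<noteq> 0} = n \<and> n > 0)" for n
  assume "\<not> independent_family T b"
  then obtain l t where "(\<Sum>t\<in>T. l t *\<^sub>R b t) = 0" "t \<in> T" "l t \<noteq> 0"
    unfolding independent_family_def by blast
  then have "P (card {t\<in>T. l t \<noteq> 0})"
    unfolding P_def using finite_T by (intro exI[of _ l]) (auto simp: card_gt_0_iff)
  then obtain n where n: "P n" "\<And>k. P k \<Longrightarrow> n \<le> k"
    using that[of "LEAST n. P n"] LeastI_ex[of P] Least_le[of P] by blast
  then obtain l where l: "(\<Sum>t\<in>T. l t *\<^sub>R b t) = 0" "card {t\<in>T. l t \<noteq> 0} = n" "n > 0"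
    unfolding P_def by blast
  then obtain i where i: "i \<in> T" "l i \<noteq> 0" by (auto simp: card_gt_0_iff)
  define k where "k t = l t / l i" for t
  have k: "(\<Sum>t\<in>T. k t *\<^sub>R b t) = 0"
  proof -
    have "(\<Sum>t\<in>T. k t *\<^sub>R b t) = (1 / l i) *\<^sub>R (\<Sum>t\<in>T. l t *\<^sub>R b t)"
      by (simp add: k_def scaleR_sum_right)
    then show ?thesis using l(1) by simp
  qed
  have x: "x \<bullet> (\<Sum>t\<in>T. k t *\<^sub>R a t) = 0" for x
  proof -
    obtain D where D: "moves x D" using moves_exists by blast
    note der = moves_derivation[OF D]
    have rel: "(\<Sum>t\<in>T. k t * (y \<bullet> b t)) = 0" for y
    proof -
      have "(\<Sum>t\<in>T. k t * (y \<bullet> b t)) = y \<bullet> (\<Sum>t\<in>T. k t *\<^sub>R b t)" by (simp add: inner_sum_right)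
      then show ?thesis by (simp add: k)
    qed
    have Drel: "(\<Sum>t\<in>T. D (k t) * (y \<bullet> b t)) + (\<Sum>t\<in>T. k t * D (y \<bullet> b t)) = 0" for y
    proof -
      have "D (\<Sum>t\<in>T. k t * (y \<bullet> b t)) = 0" by (simp only: rel derivation_0[OF der])
      then show ?thesis
        by (simp add: derivation_sum[OF der] derivation_mult[OF der] sum.distrib mult.commute add.commute)
    qed
    \<comment> \<open>The differentiated relation again holds for \<open>b\<close>: \<open>y\<close>
      is a combination of the \<open>b t\<close>, and constancy of their inner products makes it
      orthogonal to each of them.\<close>
    define y where "y = (\<Sum>t\<in>T. D (k t) *\<^sub>R b t)"
    have "y \<bullet> b s = 0" if s: "s \<in> T" for s
    proof -
      have "(\<Sum>t\<in>T. k t * D (b s \<bullet> b t)) = 0" by (simp add: gram_constant[OF D s])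
      then have "b s \<bullet> y = 0" using Drel[of "b s"] by (simp add: y_def inner_sum_right)
      then show ?thesis by (simp add: inner_commute)
    qed
    then have "y \<bullet> y = 0" by (subst (2) y_def) (simp add: inner_sum_right)
    then have y0: "(\<Sum>t\<in>T. D (k t) *\<^sub>R b t) = 0" by (simp add: y_def)
    have "D (k t) = 0" if "t \<in> T" for t
    proof (rule ccontr)
      assume "D (k t) \<noteq> 0"
      then have "card {t\<in>T. D (k t) \<noteq> 0} > 0" using that finite_T by (auto simp: card_gt_0_iff)
      then have "P (card {t\<in>T. D (k t) \<noteq> 0})" unfolding P_def using y0 by (intro exI[of _ "\<lambda>t. D (k t)"] conjI) simp_all
      then have "n \<le> card {t\<in>T. D (k t) \<noteq> 0}" by (rule n(2))
      moreover have "{t\<in>T. D (k t) \<noteq> 0} \<subset> {t\<in>T. l t \<noteq> 0}"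
      proof
        have "l t \<noteq> 0" if "D (k t) \<noteq> 0" for t
          using that derivation_0[OF der] by (auto simp: k_def)
        then show "{t\<in>T. D (k t) \<noteq> 0} \<subseteq> {t\<in>T. l t \<noteq> 0}" by blast
        have "D (k i) = 0" using i by (simp add: k_def derivation_1[OF der])
        then show "{t\<in>T. D (k t) \<noteq> 0} \<noteq> {t\<in>T. l t \<noteq> 0}" using i by blast
      qed
      then have "card {t\<in>T. D (k t) \<noteq> 0} < n"
        using finite_T l(2) psubset_card_mono[of "{t\<in>T. l t \<noteq> 0}"] by simp
      ultimately show False by simp
    qed
    then have "(\<Sum>t\<in>T. k t * D ((q v - q u) \<bullet> b t)) = 0"
      using Drel[of "q v - q u"] by simp
    then show ?thesis by (simp add: moves_inner_b[OF D] inner_sum_right)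
  qed
  have "(\<Sum>t\<in>T. k t *\<^sub>R a t) = 0" using x[of "\<Sum>t\<in>T. k t *\<^sub>R a t"] by simp
  from independent_familyD[OF independent_a this i(1)] show False using i by (simp add: k_def)
qed

text \<open>Let \<open>h\<close> be the coordinates of \<open>q v - q u\<close> in the basis
  \<open>b\<close>. Differentiating the edge equation at \<open>u\<close> shows that
  \<open>p v - p u\<close> has the same coordinates in \<open>a\<close>. Differentiating these
  coordinates in the direction \<open>a s\<close> then identifies the Gram matrices entry by
  entry.\<close>

lemma star_congruent:
  obtains h where "p v - p u = (\<Sum>t\<in>T. h t *\<^sub>R a t)" "q v - q u = (\<Sum>t\<in>T. h t *\<^sub>R b t)"
    "\<And>s t. s \<in> T \<Longrightarrow> t \<in> T \<Longrightarrow> a s \<bullet> a t = b s \<bullet> b t"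
proof -
  define z w where "z = p v - p u" and "w = q v - q u"
  obtain h where h: "w = (\<Sum>t\<in>T. h t *\<^sub>R b t)"
    using independent_family_spans[OF finite_T independent_b, of w] T(2) by auto
  have "w \<bullet> w = (\<Sum>t\<in>T. h t * (w \<bullet> b t))"
    by (subst (2) h) (simp add: inner_sum_right)
  then have zw: "z \<bullet> z = (\<Sum>t\<in>T. h t * (w \<bullet> b t))"
    using edge_inner[OF u] by (simp add: z_def w_def)
  \<comment> \<open>The linear system for \<open>h\<close>, whose matrix is the constant Gram matrix
    of \<open>b\<close>, differentiated.\<close>
  have row: "(\<Sum>s\<in>T. D (h s) * (b s \<bullet> b t)) = x \<bullet> a t" if D: "moves x D" and t: "t \<in> T" for D x t
  proof -
    note der = moves_derivation[OF D]
    have "w \<bullet> b t = (\<Sum>s\<in>T. h s * (b s \<bullet> b t))" by (subst h) (simp add: inner_sum_left)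
    then have "D (w \<bullet> b t) = (\<Sum>s\<in>T. h s * D (b s \<bullet> b t)) + (\<Sum>s\<in>T. D (h s) * (b s \<bullet> b t))"
      by (simp add: derivation_sum[OF der] derivation_mult[OF der] sum.distrib mult.commute)
    then show ?thesis
      using moves_inner_b[OF D t] by (simp add: w_def gram_constant[OF D _ t])
  qed
  have zx: "x \<bullet> z = x \<bullet> (\<Sum>t\<in>T. h t *\<^sub>R a t)" for x
  proof -
    obtain D where D: "moves x D" using moves_exists by blast
    note der = moves_derivation[OF D]
    have "2 * (x \<bullet> z) = D (z \<bullet> z)"
      using moves_z[OF D] by (simp add: derivation_inner[OF der] z_def inner_commute)
    also have "\<dots> = (\<Sum>t\<in>T. D (h t) * (w \<bullet> b t)) + (\<Sum>t\<in>T. h t * (x \<bullet> a t))"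
      by (simp add: zw derivation_sum[OF der] derivation_mult[OF der] sum.distrib moves_inner_b[OF D]
          w_def mult.commute)
    also have "(\<Sum>t\<in>T. D (h t) * (w \<bullet> b t)) = (\<Sum>t\<in>T. \<Sum>s\<in>T. D (h t) * (h s * (b s \<bullet> b t)))"
      by (subst h) (simp add: inner_sum_left sum_distrib_left)
    \<comment> \<open>By symmetry of the Gram matrix \<open>row\<close> applies, and this sum equals
      the other summand.\<close>
    also have "\<dots> = (\<Sum>s\<in>T. h s * (\<Sum>t\<in>T. D (h t) * (b t \<bullet> b s)))"
      by (subst sum.swap) (simp add: sum_distrib_left inner_commute mult_ac)
    also have "\<dots> = (\<Sum>s\<in>T. h s * (x \<bullet> a s))" by (simp add: row[OF D])
    finally show ?thesis by (simp add: inner_sum_right)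
  qed
  have "(z - (\<Sum>t\<in>T. h t *\<^sub>R a t)) \<bullet> (z - (\<Sum>t\<in>T. h t *\<^sub>R a t)) = 0"
    by (subst inner_diff_right) (simp add: zx)
  then have z: "z = (\<Sum>t\<in>T. h t *\<^sub>R a t)" by simp
  have gram: "a s \<bullet> a t = b s \<bullet> b t" if s: "s \<in> T" and t: "t \<in> T" for s t
  proof -
    \<comment> \<open>Since the \<open>a t\<close> are constants, differentiating \<open>z\<close>
      expands \<open>a s\<close> with coefficients \<open>D (h t)\<close>; by independence these are
      1 at \<open>s\<close> and 0 elsewhere.\<close>
    obtain D where D: "moves (a s) D" using moves_exists by blast
    note der = moves_derivation[OF D]
    have "a s = derivation_vec D (\<Sum>t\<in>T. h t *\<^sub>R a t)"
      using moves_z[OF D] by (simp add: z[symmetric] z_def)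
    also have "\<dots> = (\<Sum>t\<in>T. D (h t) *\<^sub>R a t)"
      by (simp add: derivation_vec_sum_scaleR[OF der] moves_a[OF D])
    finally have as: "a s = (\<Sum>t\<in>T. D (h t) *\<^sub>R a t)" .
    define k where "k t = D (h t) - (if t = s then 1 else 0)" for t
    have "(\<Sum>t\<in>T. k t *\<^sub>R a t) = (\<Sum>t\<in>T. D (h t) *\<^sub>R a t) - a s"
      using finite_T s by (simp add: k_def scaleR_diff_left sum_subtractf if_distrib[of "\<lambda>c. c *\<^sub>R _"] cong: if_cong)
    then have "(\<Sum>t\<in>T. k t *\<^sub>R a t) = 0" using as by simp
    then have "k r = 0" if "r \<in> T" for r using independent_familyD[OF independent_a] that by blast
    then have "D (h r) = (if r = s then 1 else 0)" if "r \<in> T" for r using that by (simp add: k_def)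
    then have "(\<Sum>r\<in>T. D (h r) * (b r \<bullet> b t)) = (\<Sum>r\<in>T. (if r = s then 1 else 0) * (b r \<bullet> b t))"
      by simp
    also have "\<dots> = b s \<bullet> b t"
      using finite_T s by (simp add: if_distrib[of "\<lambda>c. c * _"] cong: if_cong)
    finally show ?thesis using row[OF D t] by simp
  qed
  show ?thesis using that[of h] z h gram by (simp add: z_def w_def)
qed

lemma neighbour_congruent:
  assumes "t \<in> T" shows "norm (p t - p u) = norm (q t - q u)"
proof -
  have "a t \<bullet> a t = b t \<bullet> b t" by (rule star_congruent) (use assms in blast)
  then show ?thesis by (simp add: norm_eq a_def b_def)
qed

text \<open>As \<open>v\<close> has the same coordinates \<open>h\<close> over congruent bases, its
  inner products with the vector from \<open>u\<close> to \<open>x\<close> agree at \<open>p\<close>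
  and \<open>q\<close>; with the edge from \<open>v\<close> to \<open>u\<close> they determine the
  distance to \<open>x\<close>.\<close>

lemma extend_congruence:
  assumes cong: "\<And>x y. x \<in> V - {v} \<Longrightarrow> y \<in> V - {v} \<Longrightarrow> norm (p x - p y) = norm (q x - q y)"
    and x: "x \<in> V - {v}"
  shows "norm (p v - p x) = norm (q v - q x)"
proof -
  obtain h where h: "p v - p u = (\<Sum>t\<in>T. h t *\<^sub>R a t)" "q v - q u = (\<Sum>t\<in>T. h t *\<^sub>R b t)"
    by (rule star_congruent)
  have sq: "(p x - p y) \<bullet> (p x - p y) = (q x - q y) \<bullet> (q x - q y)" if "x \<in> V - {v}" "y \<in> V - {v}" for x y
    using cong[OF that] by (simp add: norm_eq)
  have "a t \<bullet> a x = b t \<bullet> b x" if "t \<in> T" for t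
  proof (rule inner_polarization)
    show "(a t - a x) \<bullet> (a t - a x) = (b t - b x) \<bullet> (b t - b x)"
      using sq[of t x] x that in_V by (auto simp: a_def b_def)
  qed (use sq x that in_V in \<open>auto simp: a_def b_def\<close>)
  then have "(p v - p u) \<bullet> a x = (q v - q u) \<bullet> b x"
    unfolding h by (simp add: inner_sum_left)
  moreover have "a x \<bullet> a x = b x \<bullet> b x" using sq[OF x in_V(1)] by (simp add: a_def b_def)
  ultimately have "(p v - p u - a x) \<bullet> (p v - p u - a x) = (q v - q u - b x) \<bullet> (q v - q u - b x)"
    using edge_inner[OF u] by (simp add: inner_diff_left inner_diff_right inner_commute)
  then show ?thesis by (simp add: a_def b_def norm_eq)
qed

end

section \<open>Induction on the number of vertices\<close>

lemma delete_delete_neighbour_clique: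
  "delete_vertex_edges v (delete_vertex_edges w E) \<union> complete_edges (neighbours (delete_vertex_edges w E) v)
    \<subseteq> delete_vertex_edges w (delete_vertex_edges v E \<union> complete_edges (neighbours E v))"
  by (auto simp: delete_vertex_edges_def complete_edges_def neighbours_def)

lemma inf_rigid_mono: "inf_rigid V E p \<Longrightarrow> E \<subseteq> F \<Longrightarrow> inf_rigid V F p"
  unfolding inf_rigid_def using infinitesimal_motion_mono by blast

text \<open>Here \<open>U\<close> only has to contain the vertices with nonrigid deletion. Thus the
  same set serves for the reduced graph, where deleting a vertex of \<open>U\<close> may have become
  harmless.\<close>

lemma congruent_if_vertex_deletions_rigid:
  fixes p q :: "'v \<Rightarrow> real ^ 'd"
  assumes "generic V p" "finite V" "E \<subseteq> complete_edges V" "card V \<ge> CARD('d) + 2"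
    and "U \<subseteq> V" "card U \<le> CARD('d) - 1"
    and "\<And>v. v \<in> V - U \<Longrightarrow> inf_rigid (V - {v}) (delete_vertex_edges v E) p"
    and "equivalent_frameworks E p q" and "x \<in> V" "y \<in> V"
  shows "norm (p x - p y) = norm (q x - q y)"
  using assms
proof (induction "card V" arbitrary: V E U x y)
  case 0
  then show ?case by simp
next
  case (Suc n)
  note p = \<open>generic V p\<close> and V = \<open>finite V\<close> and E = \<open>E \<subseteq> complete_edges V\<close>
    and rigid = \<open>\<And>v. v \<in> V - U \<Longrightarrow> inf_rigid (V - {v}) (delete_vertex_edges v E) p\<close>
  have d: "CARD('d) \<ge> 1" by (simp add: Suc_leI)
  have "finite U" using Suc.prems(5) V finite_subset by blast
  have degree: "card (neighbours (delete_vertex_edges w E) v) \<ge> CARD('d)"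
    if "v \<in> V" "w \<in> V - U" "v \<noteq> w" for v w
  proof (rule inf_rigid_degree)
    show "generic (V - {w}) p" using generic_subset[OF p] by blast
    show "delete_vertex_edges w E \<subseteq> complete_edges (V - {w})" by (rule delete_vertex_edges_subset[OF E])
    show "inf_rigid (V - {w}) (delete_vertex_edges w E) p" using rigid that by blast
    show "CARD('d) + 1 \<le> card (V - {w})" using Suc.prems(4) that V by simp
  qed (use V that in auto)
  show ?case
  proof (cases "card V = CARD('d) + 2")
    case True
    show ?thesis
    proof (cases "x = y")
      case False
      \<comment> \<open>At most \<open>d - 1\<close> vertices lie in \<open>U\<close> and two more
        are excluded, which leaves a choice of \<open>w\<close> among \<open>d + 2\<close>. On the
        \<open>d + 1\<close> vertices of \<open>G - w\<close>, minimum degree \<open>d\<close> means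
        completeness.\<close>
      have "card (U \<union> {x, y}) \<le> card U + 2"
        using card_Un_le[of U "{x, y}"] False by simp
      then have "card (U \<union> {x, y}) < card V" using Suc.prems(6) True d by linarith
      then obtain w where w: "w \<in> V" "w \<notin> U \<union> {x, y}"
        using card_mono[of "U \<union> {x, y}" V] \<open>finite U\<close> by (metis finite.emptyI finite_UnI finite_insert not_le subsetI)
      define N where "N = neighbours (delete_vertex_edges w E) y"
      have "N \<subseteq> V - {w} - {y}"
        unfolding N_def by (rule neighbours_subset[OF delete_vertex_edges_subset[OF E]])
      moreover have "card (V - {w} - {y}) = CARD('d)" using w V True Suc.prems by auto
      moreover have "card N \<ge> CARD('d)" unfolding N_def using degree w Suc.prems by auto
      ultimately have "N = V - {w} - {y}" using V by (intro card_subset_eq) (auto intro: antisym dest: card_mono[rotated])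
      then have "x \<in> N" using False w Suc.prems by auto
      then have "{x, y} \<in> E" by (simp add: N_def neighbours_def delete_vertex_edges_def)
      then show ?thesis using Suc.prems(8) by (simp add: equivalent_frameworks_def)
    qed simp
  next
    case False
    then have big: "card V \<ge> CARD('d) + 3" using Suc.prems(4) by simp
    have "card U < card V" using big Suc.prems(6) by simp
    then obtain v where v: "v \<in> V" "v \<notin> U"
      using card_mono[OF \<open>finite U\<close>, of V] by (meson not_le subsetI)
    define N where "N = neighbours E v"
    have N: "N \<subseteq> V - {v}" unfolding N_def by (rule neighbours_subset[OF E])
    have "finite N" using N V finite_subset by blast
    have sub: "neighbours (delete_vertex_edges w E) v \<subseteq> N - {w}" for w
      by (auto simp: N_def neighbours_def delete_vertex_edges_def)
    have degree': "CARD('d) \<le> card (N - {w})" if "w \<in> V - U" "w \<noteq> v" for w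
      using degree[of v w] that v card_mono[OF _ sub[of w]] \<open>finite N\<close> by fastforce
    have "card (U \<union> {v}) < card V"
      using card_Un_le[of U "{v}"] Suc.prems(6) big by simp
    then obtain w where w: "w \<in> V" "w \<notin> U \<union> {v}"
      using card_mono[of "U \<union> {v}" V] \<open>finite U\<close> by (metis finite.emptyI finite_UnI finite_insert not_le subsetI)
    have "CARD('d) \<le> card N" using degree'[of w] w card_mono[of N "N - {w}"] \<open>finite N\<close> by auto
    then have "card U < card N" using Suc.prems(6) d by linarith
    \<comment> \<open>Deleting a neighbour outside \<open>U\<close> leaves \<open>v\<close> with at
      least \<open>d\<close> neighbours, so \<open>N\<close> has at least \<open>d + 1\<close>
      elements.\<close>
    then obtain w' where w': "w' \<in> N" "w' \<notin> U"
      using card_mono[OF \<open>finite U\<close>, of N] by (meson not_le subsetI)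
    then have degN: "card (N - {r}) \<ge> CARD('d)" if "r \<in> N" for r
      using degree'[of w'] N that \<open>finite N\<close> by auto
    define E' where "E' = delete_vertex_edges v E \<union> complete_edges N"
    have star: "vertex_star V E p q v u T" if "u \<in> N" "T \<subseteq> N - {u}" "card T = CARD('d)" for u T
      using p V E v rigid[of v] Suc.prems(8) that unfolding N_def by unfold_locales auto
    have congN: "norm (p r - p s) = norm (q r - q s)" if rs: "r \<in> N" "s \<in> N" for r s
    proof (cases "r = s")
      case False
      \<comment> \<open>With \<open>s\<close> as origin, \<open>r\<close> and \<open>d - 1\<close>
        further neighbours form a star that contains the given pair.\<close>
      have "CARD('d) - 1 \<le> card (N - {s} - {r})"
        using degN[OF rs(2)] rs False \<open>finite N\<close> by simp
      then obtain T where T: "T \<subseteq> N - {s} - {r}" "card T = CARD('d) - 1" "finite T"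
        using obtain_subset_with_card_n by blast
      have cardT: "card (insert r T) = CARD('d)"
        using T d by (subst card_insert_disjoint) auto
      interpret vertex_star V E p q v s "insert r T"
        by (rule star[OF rs(2) _ cardT]) (use T rs False in auto)
      show ?thesis by (rule neighbour_congruent) simp
    qed simp
    have E': "E' \<subseteq> complete_edges (V - {v})"
      unfolding E'_def using delete_vertex_edges_subset[OF E] complete_edges_mono[OF N] by blast
    have eq': "equivalent_frameworks E' p q"
      using Suc.prems(8) congN
      by (auto simp: equivalent_frameworks_def E'_def delete_vertex_edges_def complete_edges_iff)
    have cong: "norm (p r - p s) = norm (q r - q s)" if rs: "r \<in> V - {v}" "s \<in> V - {v}" for r s
    proof (rule Suc.hyps(1)[of "V - {v}" E' U])
      show "n = card (V - {v})" using Suc.hyps(2) v V by simp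
      show "generic (V - {v}) p" using generic_subset[OF p] by blast
      show "card (V - {v}) \<ge> CARD('d) + 2" using big v V by simp
      show "U \<subseteq> V - {v}" using Suc.prems(5) v by blast
      fix w assume w: "w \<in> V - {v} - U"
      let ?F = "delete_vertex_edges w E"
      have "inf_rigid (V - {w} - {v}) (delete_vertex_edges v ?F \<union> complete_edges (neighbours ?F v)) p"
      proof (rule inf_rigid_neighbour_clique)
        show "generic (V - {w}) p" using generic_subset[OF p] by blast
        show "?F \<subseteq> complete_edges (V - {w})" by (rule delete_vertex_edges_subset[OF E])
        show "inf_rigid (V - {w}) ?F p" using rigid w by blast
        show "CARD('d) \<le> card (neighbours ?F v)" using degree w v by blast
      qed (use V v w in auto)
      \<comment> \<open>Deleting \<open>w\<close> first only shrinks the neighbourhood of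
        \<open>v\<close>, so the reduction of \<open>G - w\<close> at \<open>v\<close> is contained
        in the reduced graph with \<open>w\<close> deleted.\<close>
      then have "inf_rigid (V - {w} - {v}) (delete_vertex_edges w E') p"
        unfolding E'_def N_def by (rule inf_rigid_mono[OF _ delete_delete_neighbour_clique])
      moreover have "V - {w} - {v} = V - {v} - {w}" by blast
      ultimately show "inf_rigid (V - {v} - {w}) (delete_vertex_edges w E') p" by simp
    qed (use V E' eq' Suc.prems(6) rs in auto)
    obtain T where T: "T \<subseteq> N - {w'}" "card T = CARD('d)"
      using obtain_subset_with_card_n[OF degN[OF w'(1)]] by blast
    interpret vertex_star V E p q v w' T using star w' T by blast
    \<comment> \<open>The induction hypothesis covers all pairs avoiding \<open>v\<close>; a star at
      \<open>v\<close> adds the pairs containing it.\<close>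
    have "norm (p v - p r) = norm (q v - q r)" if "r \<in> V - {v}" for r
      using extend_congruence cong that by blast
    then show ?thesis
      using cong Suc.prems(9,10) by (cases "x = v"; cases "y = v") (auto simp: norm_minus_commute[of _ "p v"] norm_minus_commute[of _ "q v"])
  qed
qed

theorem theorem3p4:
  fixes V U :: "'v set" and E :: "'v set set"
  assumes "simple_graph V E"
    and "card V \<ge> CARD('d::finite) + 2"
    and "U = {v \<in> V. \<not> rigid TYPE('d) (V - {v}) (delete_vertex_edges v E)}"
    and "card U \<le> CARD('d) - 1"
  shows "globally_rigid TYPE('d) V E"
  unfolding globally_rigid_def
proof (intro allI impI ballI)
  fix p q :: "'v \<Rightarrow> real ^ 'd" and x y
  assume p: "generic V p" and pq: "\<forall>x y. {x, y} \<in> E \<longrightarrow> norm (p x - p y) = norm (q x - q y)"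
    and xy: "x \<in> V" "y \<in> V"
  have V: "finite V" and E: "E \<subseteq> complete_edges V"
    using assms(1) by (auto simp: simple_graph_def)
  show "norm (p x - p y) = norm (q x - q y)"
  proof (rule congruent_if_vertex_deletions_rigid[OF p V E assms(2) _ assms(4) _ _ xy])
    show "U \<subseteq> V" using assms(3) by blast
    show "equivalent_frameworks E p q" using pq by (simp add: equivalent_frameworks_def)
    fix v assume "v \<in> V - U"
    then have "rigid TYPE('d) (V - {v}) (delete_vertex_edges v E)" using assms(3) by blast
    moreover have "simple_graph (V - {v}) (delete_vertex_edges v E)"
      using V delete_vertex_edges_subset[OF E] by (simp add: simple_graph_def)
    moreover have "generic (V - {v}) p" using generic_subset[OF p] by blast
    ultimately show "inf_rigid (V - {v}) (delete_vertex_edges v E) p"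
      by (intro rigid_imp_inf_rigid)
  qed
qed

end
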